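(* Let $(M_{\rm ext}, g_{\rm ext})$ be a continuous extension of a smooth spacetime $(M,g)$ such that $M = I^+(\mathcal{O}, M_{\rm ext})$ for some point $\mathcal{O} \in \partial^- M$. Assume the following. (a) $(M,g)$ solves the Einstein equations with a perfect fluid $(u,\rho,p)$, i.e. $\mathrm{Ric} - \frac{1}{2}Rg = 8\pi\big[(\rho+p)\,u_*\otimes u_* + p\,g\big]$ on $M$. (b) All the integral curves of $u$ have past endpoint $\mathcal{O}$ within $M_{\rm ext}$. Moreover, each of these extended curves is a future directed timelike curve in $M_{\rm ext}$ on any compact domain; that is, if $\gamma\colon[0,b]\to M\cup\{\mathcal{O}\}$ is an integral curve of $u$ on $(0,b]$ with past endpoint $\gamma(0)=\mathcal{O}$, then $\gamma$ is a future directed timelike curve within $M_{\rm ext}$. (c) The Ricci tensor $\mathrm{Ric}$ of $(M,g)$, the function $\rho$, and the function $p$ all extend continuously to $M\cup\{\mathcal{O}\}$. (d) $(M_{\rm ext}, g_{\rm ext})$ is strongly causal at $\mathcal{O}$. Then the continuous extensions $\widetilde{\rho}$ and $\widetilde{p}$ of $\rho$ and $p$ to $M\cup\{\mathcal{O}\}$ satisfy $\widetilde{\rho}(\mathcal{O}) = -\widetilde{p}(\mathcal{O})$.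
   Context: Spacetimes. A spacetime $(M,g)$ is a smooth (connected, Hausdorff, second countable) manifold $M$ of dimension $n+1$ with a time-oriented Lorentzian metric $g$ of signature $(-,+,\dots,+)$. It is smooth (resp. continuous) if the components $g_{\mu\nu}=g(\partial_\mu,\partial_\nu)$ are smooth (resp. continuous) in any coordinates $(x^0,\dots,x^n)$; the manifold is always smooth. Curves. In a continuous spacetime, a future directed causal curve is a locally Lipschitz curve $\gamma$ (with respect to some complete smooth Riemannian metric) such that $\gamma'$ is future directed causal (in particular nonzero) almost everywhere. A future directed timelike curve $\gamma\colon[a,b]\to M$ is a Lipschitz curve that is future directed timelike almost everywhere and satisfies $g(\gamma',\gamma')<-\varepsilon$ almost everywhere for some $\varepsilon>0$. $I^+(q,M)$ is the set of endpoints of future directed timelike curves in $M$ starting at $q$. Extensions. A continuous spacetime $(M_{\rm ext},g_{\rm ext})$ is a continuous extension of a smooth spacetime $(M,g)$ if $M$ and $M_{\rm ext}$ have the same dimension and there is an isometric embedding $(M,g)\hookrightarrow(M_{\rm ext},g_{\rm ext})$ preserving time orientations whose image is a proper subset; $M$ is identified with its image. $\partial M=\overline{M}\setminus M$ is the topological boundary of $M$ in $M_{\rm ext}$. The past boundary $\partial^-M$ is the set of $q\in\partial M$ for which there is a future directed timelike curve $\gamma\colon[a,b]\to M_{\rm ext}$ with $\gamma(a)=q$ and $\gamma((a,b])\subset M$. Perfect fluid. $u$ is a smooth future directed timelike vector field on $M$ with $g(u,u)=-1$, $\rho$ and $p$ are smooth real functions on $M$, $u_*=g(u,\cdot)$ is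 the one-form metrically equivalent to $u$, and $R$ is the scalar curvature of $g$. Past endpoint. An integral curve of $u$ (maximally extended to the past) has past endpoint $\mathcal{O}$ if, after translating its parameter so that its domain begins at $0$, it extends continuously to parameter $0$ with value $\mathcal{O}$ there. Continuous extension to $M\cup\{\mathcal{O}\}$. $M\cup\{\mathcal{O}\}$ carries the subspace topology from $M_{\rm ext}$. A smooth function $f$ on $M$ extends continuously to $M\cup\{\mathcal{O}\}$ if there is a continuous $\widetilde f\colon M\cup\{\mathcal{O}\}\to\mathbb{R}$ with $\widetilde f|_M=f$; $\widetilde f$ is called the continuous extension of $f$. A smooth tensor on $M$ extends continuously to $M\cup\{\mathcal{O}\}$ if there is a coordinate neighborhood $U\subset M_{\rm ext}$ of $\mathcal{O}$ such that each component of the tensor in the coordinates on $U$ extends continuously to $(U\cap M)\cup\{\mathcal{O}\}$ (this does not depend on the coordinates). Strong causality. $(M_{\rm ext},g_{\rm ext})$ is strongly causal at $\mathcal{O}$ if for any neighborhood $U$ of $\mathcal{O}$ there is a neighborhood $V\subset U$ of $\mathcal{O}$ such that for every future directed causal curve $\gamma\colon[a,b]\to M_{\rm ext}$ with $\gamma(a),\gamma(b)\in V$ one has $\gamma([a,b])\subset U$. *)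

theory Defs
  imports "HOL-Analysis.Analysis"
begin

section \<open>Smooth manifolds\<close>

text \<open>Iterated Frechet differentiability; meant for open \<open>S\<close>.\<close>

primrec Ck_on :: "nat \<Rightarrow> 'x::real_normed_vector set \<Rightarrow> ('x \<Rightarrow> 'y::real_normed_vector) \<Rightarrow> bool" where
  "Ck_on 0 S f \<longleftrightarrow> continuous_on S f"
| "Ck_on (Suc k) S f \<longleftrightarrow> (\<forall>x\<in>S. f differentiable (at x)) \<and>
     (\<forall>v. Ck_on k S (\<lambda>x. frechet_derivative f (at x) v))"

definition smooth_on :: "'x::real_normed_vector set \<Rightarrow> ('x \<Rightarrow> 'y::real_normed_vector) \<Rightarrow> bool" where
  "smooth_on S f \<longleftrightarrow> (\<forall>k. Ck_on k S f)"

text \<open>A chart is a domain together with a coordinate map; the values of the coordinate map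
  outside the domain are irrelevant. The dimension of the manifold is \<open>CARD('d)\<close>.\<close>

type_synonym ('a, 'd) chart = "'a set \<times> ('a \<Rightarrow> real ^ 'd)"

abbreviation cdom :: "('a, 'd::finite) chart \<Rightarrow> 'a set" where "cdom \<equiv> fst"
abbreviation crd :: "('a, 'd::finite) chart \<Rightarrow> 'a \<Rightarrow> real ^ 'd" where "crd \<equiv> snd"

definition cinv :: "('a, 'd::finite) chart \<Rightarrow> real ^ 'd \<Rightarrow> 'a" where
  "cinv c = inv_into (cdom c) (crd c)"

definition is_chart :: "'a topology \<Rightarrow> ('a, 'd::finite) chart \<Rightarrow> bool" where
  "is_chart T c \<longleftrightarrow> openin T (cdom c) \<and> open (crd c ` cdom c) \<and>
     homeomorphic_map (subtopology T (cdom c)) (top_of_set (crd c ` cdom c)) (crd c)"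

definition smoothly_compatible :: "('a, 'd::finite) chart \<Rightarrow> ('a, 'd) chart \<Rightarrow> bool" where
  "smoothly_compatible c c' \<longleftrightarrow>
     smooth_on (crd c ` (cdom c \<inter> cdom c')) (crd c' \<circ> cinv c) \<and>
     smooth_on (crd c' ` (cdom c \<inter> cdom c')) (crd c \<circ> cinv c')"

text \<open>Atlases are maximal: the last clause says both that the charts of \<open>A\<close> are pairwise
  compatible and that every chart compatible with all of \<open>A\<close> belongs to \<open>A\<close>.\<close>

definition smooth_manifold :: "'a topology \<Rightarrow> ('a, 'd::finite) chart set \<Rightarrow> bool" where
  "smooth_manifold T A \<longleftrightarrow>
     connected_space T \<and> Hausdorff_space T \<and> second_countable T \<and>
     \<Union> (cdom ` A) = topspace T \<and>
     A = {c. is_chart T c \<and> (\<forall>c'\<in>A. smoothly_compatible c c')}"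

text \<open>Jacobian matrix at the point \<open>x\<close> of a map \<open>f\<close>, in the coordinates \<open>c\<close> and \<open>c'\<close>.\<close>

definition jac :: "('a, 'd::finite) chart \<Rightarrow> ('a \<Rightarrow> 'b) \<Rightarrow> ('b, 'd) chart \<Rightarrow> 'a \<Rightarrow> real ^ 'd ^ 'd" where
  "jac c f c' x = matrix (frechet_derivative (crd c' \<circ> f \<circ> cinv c) (at (crd c x)))"

section \<open>Tensor fields\<close>

text \<open>Tensor fields are given by their components in every chart of the atlas, subject to the
  transformation law. Only the components \<open>X c x\<close> with \<open>c \<in> A\<close> and \<open>x \<in> cdom c\<close> matter.\<close>

type_synonym ('a, 'd) vfield = "('a, 'd) chart \<Rightarrow> 'a \<Rightarrow> real ^ 'd"
type_synonym ('a, 'd) tensor2 = "('a, 'd) chart \<Rightarrow> 'a \<Rightarrow> real ^ 'd ^ 'd"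

definition vector_field :: "('a, 'd::finite) chart set \<Rightarrow> ('a, 'd) vfield \<Rightarrow> bool" where
  "vector_field A X \<longleftrightarrow> (\<forall>c\<in>A. \<forall>c'\<in>A. \<forall>x \<in> cdom c \<inter> cdom c'.
     X c' x = jac c id c' x *v X c x)"

text \<open>Covariant tensor fields of rank 2.\<close>

definition cov2_tensor :: "('a, 'd::finite) chart set \<Rightarrow> ('a, 'd) tensor2 \<Rightarrow> bool" where
  "cov2_tensor A h \<longleftrightarrow> (\<forall>c\<in>A. \<forall>c'\<in>A. \<forall>x \<in> cdom c \<inter> cdom c'.
     h c x = transpose (jac c id c' x) ** h c' x ** jac c id c' x)"

definition continuous_comps ::
  "('a, 'd::finite) chart set \<Rightarrow> (('a, 'd) chart \<Rightarrow> 'a \<Rightarrow> 'y::real_normed_vector) \<Rightarrow> bool" where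
  "continuous_comps A F \<longleftrightarrow> (\<forall>c\<in>A. continuous_on (crd c ` cdom c) (F c \<circ> cinv c))"

definition smooth_comps ::
  "('a, 'd::finite) chart set \<Rightarrow> (('a, 'd) chart \<Rightarrow> 'a \<Rightarrow> 'y::real_normed_vector) \<Rightarrow> bool" where
  "smooth_comps A F \<longleftrightarrow> (\<forall>c\<in>A. smooth_on (crd c ` cdom c) (F c \<circ> cinv c))"

definition smooth_function :: "('a, 'd::finite) chart set \<Rightarrow> ('a \<Rightarrow> real) \<Rightarrow> bool" where
  "smooth_function A f \<longleftrightarrow> smooth_comps A (\<lambda>c. f)"

section \<open>Spacetimes\<close>

text \<open>Symmetric bilinear form of signature \<open>(-,+,\<dots>,+)\<close>.\<close>

definition lorentzian_matrix :: "real ^ 'd::finite ^ 'd \<Rightarrow> bool" where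
  "lorentzian_matrix G \<longleftrightarrow> transpose G = G \<and>
     (\<exists>(P :: real ^ 'd ^ 'd) i0. invertible P \<and>
        transpose P ** G ** P = (\<chi> i j. if i = j then (if i = i0 then - 1 else 1) else 0))"

text \<open>The time orientation is represented by a continuous timelike vector field, which is
  declared to be future directed.\<close>

record ('a, 'd::finite) spacetime =
  st_top :: "'a topology"
  st_atlas :: "('a, 'd) chart set"
  st_metric :: "('a, 'd) tensor2"
  st_orient :: "('a, 'd) vfield"

abbreviation pts :: "('a, 'd::finite) spacetime \<Rightarrow> 'a set" where
  "pts M \<equiv> topspace (st_top M)"

definition ginner :: "('a, 'd::finite) spacetime \<Rightarrow> ('a, 'd) chart \<Rightarrow> 'a \<Rightarrow> real ^ 'd \<Rightarrow> real ^ 'd \<Rightarrow> real" where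
  "ginner M c x v w = v \<bullet> (st_metric M c x *v w)"

definition future_causal :: "('a, 'd::finite) spacetime \<Rightarrow> ('a, 'd) chart \<Rightarrow> 'a \<Rightarrow> real ^ 'd \<Rightarrow> bool" where
  "future_causal M c x v \<longleftrightarrow> v \<noteq> 0 \<and> ginner M c x v v \<le> 0 \<and> ginner M c x (st_orient M c x) v < 0"

definition future_timelike :: "('a, 'd::finite) spacetime \<Rightarrow> ('a, 'd) chart \<Rightarrow> 'a \<Rightarrow> real ^ 'd \<Rightarrow> bool" where
  "future_timelike M c x v \<longleftrightarrow> ginner M c x v v < 0 \<and> ginner M c x (st_orient M c x) v < 0"

definition continuous_spacetime :: "('a, 'd::finite) spacetime \<Rightarrow> bool" where
  "continuous_spacetime M \<longleftrightarrow>
     smooth_manifold (st_top M) (st_atlas M) \<and>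
     cov2_tensor (st_atlas M) (st_metric M) \<and>
     continuous_comps (st_atlas M) (st_metric M) \<and>
     (\<forall>c \<in> st_atlas M. \<forall>x \<in> cdom c. lorentzian_matrix (st_metric M c x)) \<and>
     vector_field (st_atlas M) (st_orient M) \<and>
     continuous_comps (st_atlas M) (st_orient M) \<and>
     (\<forall>c \<in> st_atlas M. \<forall>x \<in> cdom c. ginner M c x (st_orient M c x) (st_orient M c x) < 0)"

definition smooth_spacetime :: "('a, 'd::finite) spacetime \<Rightarrow> bool" where
  "smooth_spacetime M \<longleftrightarrow> continuous_spacetime M \<and> smooth_comps (st_atlas M) (st_metric M)"

section \<open>Riemannian distance\<close>

definition riemannian_metric :: "'a topology \<Rightarrow> ('a, 'd::finite) chart set \<Rightarrow> ('a, 'd) tensor2 \<Rightarrow> bool" where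
  "riemannian_metric T A h \<longleftrightarrow> cov2_tensor A h \<and> smooth_comps A h \<and>
     (\<forall>c\<in>A. \<forall>x \<in> cdom c. transpose (h c x) = h c x \<and> (\<forall>v. v \<noteq> 0 \<longrightarrow> 0 < v \<bullet> (h c x *v v)))"

definition piecewise_C1_curve :: "'a topology \<Rightarrow> ('a, 'd::finite) chart set \<Rightarrow> (real \<Rightarrow> 'a) \<Rightarrow> bool" where
  "piecewise_C1_curve T A \<gamma> \<longleftrightarrow>
     continuous_map (top_of_set {0..1}) T \<gamma> \<and>
     (\<exists>F. finite F \<and> (\<forall>t \<in> {0<..<1} - F. \<forall>c\<in>A. \<gamma> t \<in> cdom c \<longrightarrow>
        (\<exists>e>0. (crd c \<circ> \<gamma>) C1_differentiable_on {t - e<..<t + e})))"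

text \<open>The choice of the chart is immaterial wherever the curve is differentiable.\<close>

definition speed :: "('a, 'd::finite) chart set \<Rightarrow> ('a, 'd) tensor2 \<Rightarrow> (real \<Rightarrow> 'a) \<Rightarrow> real \<Rightarrow> real" where
  "speed A h \<gamma> t =
     (let c = (SOME c. c \<in> A \<and> \<gamma> t \<in> cdom c);
          v = vector_derivative (crd c \<circ> \<gamma>) (at t)
      in sqrt (v \<bullet> (h c (\<gamma> t) *v v)))"

text \<open>The length is an extended nonnegative real, so that curves whose speed is not integrable
  have infinite length.\<close>

definition curve_length :: "('a, 'd::finite) chart set \<Rightarrow> ('a, 'd) tensor2 \<Rightarrow> (real \<Rightarrow> 'a) \<Rightarrow> ennreal" where
  "curve_length A h \<gamma> = (\<integral>\<^sup>+ t \<in> {0..1}. ennreal (speed A h \<gamma> t) \<partial>lborel)"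

definition riem_dist ::
  "'a topology \<Rightarrow> ('a, 'd::finite) chart set \<Rightarrow> ('a, 'd) tensor2 \<Rightarrow> 'a \<Rightarrow> 'a \<Rightarrow> real" where
  "riem_dist T A h x y =
     enn2real (INF \<gamma> \<in> {\<gamma>. piecewise_C1_curve T A \<gamma> \<and> \<gamma> 0 = x \<and> \<gamma> 1 = y}. curve_length A h \<gamma>)"

definition complete_riemannian_metric ::
  "'a topology \<Rightarrow> ('a, 'd::finite) chart set \<Rightarrow> ('a, 'd) tensor2 \<Rightarrow> bool" where
  "complete_riemannian_metric T A h \<longleftrightarrow> riemannian_metric T A h \<and>
     Metric_space.mcomplete (topspace T) (riem_dist T A h)"

section \<open>Causal and timelike curves\<close>

definition lipschitz_curve :: "('a, 'd::finite) spacetime \<Rightarrow> (real \<Rightarrow> 'a) \<Rightarrow> real \<Rightarrow> real \<Rightarrow> bool" where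
  "lipschitz_curve M \<gamma> a b \<longleftrightarrow> \<gamma> ` {a..b} \<subseteq> pts M \<and>
     (\<exists>h. complete_riemannian_metric (st_top M) (st_atlas M) h \<and>
       (\<exists>L. \<forall>s\<in>{a..b}. \<forall>t\<in>{a..b}.
          riem_dist (st_top M) (st_atlas M) h (\<gamma> s) (\<gamma> t) \<le> L * \<bar>s - t\<bar>))"

definition locally_lipschitz_curve :: "('a, 'd::finite) spacetime \<Rightarrow> (real \<Rightarrow> 'a) \<Rightarrow> real \<Rightarrow> real \<Rightarrow> bool" where
  "locally_lipschitz_curve M \<gamma> a b \<longleftrightarrow> \<gamma> ` {a..b} \<subseteq> pts M \<and>
     (\<exists>h. complete_riemannian_metric (st_top M) (st_atlas M) h \<and>
       (\<forall>r\<in>{a..b}. \<exists>e>0. \<exists>L. \<forall>s \<in> {a..b} \<inter> ball r e. \<forall>t \<in> {a..b} \<inter> ball r e.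
          riem_dist (st_top M) (st_atlas M) h (\<gamma> s) (\<gamma> t) \<le> L * \<bar>s - t\<bar>))"

definition causal_curve :: "('a, 'd::finite) spacetime \<Rightarrow> (real \<Rightarrow> 'a) \<Rightarrow> real \<Rightarrow> real \<Rightarrow> bool" where
  "causal_curve M \<gamma> a b \<longleftrightarrow> a < b \<and> locally_lipschitz_curve M \<gamma> a b \<and>
     (AE t in lebesgue_on {a..b}. \<forall>c \<in> st_atlas M. \<gamma> t \<in> cdom c \<longrightarrow>
        (\<exists>v. ((crd c \<circ> \<gamma>) has_vector_derivative v) (at t) \<and> future_causal M c (\<gamma> t) v))"

definition timelike_curve :: "('a, 'd::finite) spacetime \<Rightarrow> (real \<Rightarrow> 'a) \<Rightarrow> real \<Rightarrow> real \<Rightarrow> bool" where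
  "timelike_curve M \<gamma> a b \<longleftrightarrow> a < b \<and> lipschitz_curve M \<gamma> a b \<and>
     (\<exists>\<epsilon>>0. AE t in lebesgue_on {a..b}. \<forall>c \<in> st_atlas M. \<gamma> t \<in> cdom c \<longrightarrow>
        (\<exists>v. ((crd c \<circ> \<gamma>) has_vector_derivative v) (at t) \<and>
             future_timelike M c (\<gamma> t) v \<and> ginner M c (\<gamma> t) v v < - \<epsilon>))"

definition timelike_future :: "'a \<Rightarrow> ('a, 'd::finite) spacetime \<Rightarrow> 'a set" where
  "timelike_future q M = {\<gamma> b | \<gamma> a b. timelike_curve M \<gamma> a b \<and> \<gamma> a = q}"

definition strongly_causal_at :: "('a, 'd::finite) spacetime \<Rightarrow> 'a \<Rightarrow> bool" where
  "strongly_causal_at M q \<longleftrightarrow>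
     (\<forall>U. openin (st_top M) U \<and> q \<in> U \<longrightarrow>
       (\<exists>V. openin (st_top M) V \<and> q \<in> V \<and> V \<subseteq> U \<and>
          (\<forall>\<gamma> a b. causal_curve M \<gamma> a b \<and> \<gamma> a \<in> V \<and> \<gamma> b \<in> V \<longrightarrow> \<gamma> ` {a..b} \<subseteq> U)))"

section \<open>Extensions\<close>

text \<open>Embeddings between manifolds of the same dimension: diffeomorphisms onto an open
  submanifold.\<close>

definition smooth_embedding ::
  "('a, 'd::finite) spacetime \<Rightarrow> ('b, 'd) spacetime \<Rightarrow> ('a \<Rightarrow> 'b) \<Rightarrow> bool" where
  "smooth_embedding M N \<iota> \<longleftrightarrow>
     embedding_map (st_top M) (st_top N) \<iota> \<and> openin (st_top N) (\<iota> ` pts M) \<and>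
     (\<forall>c \<in> st_atlas M. \<forall>c' \<in> st_atlas N.
        smooth_on (crd c ` (cdom c \<inter> \<iota> -` cdom c')) (crd c' \<circ> \<iota> \<circ> cinv c) \<and>
        smooth_on (crd c' ` (\<iota> ` cdom c \<inter> cdom c')) (crd c \<circ> inv_into (pts M) \<iota> \<circ> cinv c'))"

definition isometric_embedding ::
  "('a, 'd::finite) spacetime \<Rightarrow> ('b, 'd) spacetime \<Rightarrow> ('a \<Rightarrow> 'b) \<Rightarrow> bool" where
  "isometric_embedding M N \<iota> \<longleftrightarrow> smooth_embedding M N \<iota> \<and>
     (\<forall>c \<in> st_atlas M. \<forall>c' \<in> st_atlas N. \<forall>x \<in> cdom c \<inter> \<iota> -` cdom c'.
        st_metric M c x = transpose (jac c \<iota> c' x) ** st_metric N c' (\<iota> x) ** jac c \<iota> c' x)"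

definition preserves_time_orientation ::
  "('a, 'd::finite) spacetime \<Rightarrow> ('b, 'd) spacetime \<Rightarrow> ('a \<Rightarrow> 'b) \<Rightarrow> bool" where
  "preserves_time_orientation M N \<iota> \<longleftrightarrow>
     (\<forall>c \<in> st_atlas M. \<forall>c' \<in> st_atlas N. \<forall>x \<in> cdom c \<inter> \<iota> -` cdom c'. \<forall>v.
        future_causal M c x v \<longrightarrow> future_causal N c' (\<iota> x) (jac c \<iota> c' x *v v))"

text \<open>The embedding \<open>\<iota>\<close> is kept explicit; the image \<open>\<iota> ` pts M\<close> plays the role of \<open>M\<close>
  as a subset of the extension.\<close>

definition continuous_extension ::
  "('a, 'd::finite) spacetime \<Rightarrow> ('b, 'd) spacetime \<Rightarrow> ('a \<Rightarrow> 'b) \<Rightarrow> bool" where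
  "continuous_extension M N \<iota> \<longleftrightarrow> smooth_spacetime M \<and> continuous_spacetime N \<and>
     isometric_embedding M N \<iota> \<and> preserves_time_orientation M N \<iota> \<and> \<iota> ` pts M \<subset> pts N"

definition boundary_of_image ::
  "('a, 'd::finite) spacetime \<Rightarrow> ('b, 'd) spacetime \<Rightarrow> ('a \<Rightarrow> 'b) \<Rightarrow> 'b set" where
  "boundary_of_image M N \<iota> = (st_top N closure_of (\<iota> ` pts M)) - \<iota> ` pts M"

definition past_boundary ::
  "('a, 'd::finite) spacetime \<Rightarrow> ('b, 'd) spacetime \<Rightarrow> ('a \<Rightarrow> 'b) \<Rightarrow> 'b set" where
  "past_boundary M N \<iota> = {q \<in> boundary_of_image M N \<iota>.
     \<exists>\<gamma> a b. timelike_curve N \<gamma> a b \<and> \<gamma> a = q \<and> \<gamma> ` {a<..b} \<subseteq> \<iota> ` pts M}"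

text \<open>A chart of the extension, viewed as a chart of \<open>M\<close>.\<close>

definition pull_chart ::
  "('a, 'd::finite) spacetime \<Rightarrow> ('a \<Rightarrow> 'b) \<Rightarrow> ('b, 'd) chart \<Rightarrow> ('a, 'd) chart" where
  "pull_chart M \<iota> c = (pts M \<inter> \<iota> -` cdom c, crd c \<circ> \<iota>)"

definition is_continuous_extension_of ::
  "('a, 'd::finite) spacetime \<Rightarrow> ('b, 'd) spacetime \<Rightarrow> ('a \<Rightarrow> 'b) \<Rightarrow> 'b \<Rightarrow> ('a \<Rightarrow> real) \<Rightarrow> ('b \<Rightarrow> real) \<Rightarrow> bool" where
  "is_continuous_extension_of M N \<iota> q f f' \<longleftrightarrow>
     continuous_map (subtopology (st_top N) (\<iota> ` pts M \<union> {q})) euclideanreal f' \<and>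
     (\<forall>x \<in> pts M. f' (\<iota> x) = f x)"

definition tensor2_extends_continuously ::
  "('a, 'd::finite) spacetime \<Rightarrow> ('b, 'd) spacetime \<Rightarrow> ('a \<Rightarrow> 'b) \<Rightarrow> 'b \<Rightarrow> ('a, 'd) tensor2 \<Rightarrow> bool" where
  "tensor2_extends_continuously M N \<iota> q h \<longleftrightarrow>
     (\<exists>c \<in> st_atlas N. q \<in> cdom c \<and> (\<forall>i j. \<exists>F.
        continuous_map (subtopology (st_top N) ((cdom c \<inter> \<iota> ` pts M) \<union> {q})) euclideanreal F \<and>
        (\<forall>x \<in> pts M. \<iota> x \<in> cdom c \<longrightarrow> F (\<iota> x) = h (pull_chart M \<iota> c) x $ i $ j)))"

section \<open>Curvature\<close>

text \<open>\<open>pd k f y\<close> is the partial derivative of \<open>f\<close> in the \<open>k\<close>-th coordinate.\<close>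

definition pd :: "'d \<Rightarrow> (real ^ 'd::finite \<Rightarrow> real) \<Rightarrow> real ^ 'd \<Rightarrow> real" where
  "pd k f y = frechet_derivative f (at y) (axis k 1)"

definition gcomp :: "('a, 'd::finite) spacetime \<Rightarrow> ('a, 'd) chart \<Rightarrow> 'd \<Rightarrow> 'd \<Rightarrow> real ^ 'd \<Rightarrow> real" where
  "gcomp M c i j y = st_metric M c (cinv c y) $ i $ j"

text \<open>Christoffel symbols \<open>\<Gamma>\<^sup>k\<^sub>i\<^sub>j\<close> of the Levi-Civita connection, as functions of the coordinates.\<close>

definition christoffel :: "('a, 'd::finite) spacetime \<Rightarrow> ('a, 'd) chart \<Rightarrow> 'd \<Rightarrow> 'd \<Rightarrow> 'd \<Rightarrow> real ^ 'd \<Rightarrow> real" where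
  "christoffel M c k i j y =
     (\<Sum>l\<in>UNIV. 1/2 * matrix_inv (st_metric M c (cinv c y)) $ k $ l *
        (pd i (gcomp M c j l) y + pd j (gcomp M c i l) y - pd l (gcomp M c i j) y))"

definition ricci :: "('a, 'd::finite) spacetime \<Rightarrow> ('a, 'd) tensor2" where
  "ricci M c x =
     (let \<Gamma> = christoffel M c; y = crd c x in
      \<chi> i j. \<Sum>k\<in>UNIV.
        pd k (\<Gamma> k i j) y - pd j (\<Gamma> k i k) y
        + (\<Sum>l\<in>UNIV. \<Gamma> k k l y * \<Gamma> l i j y - \<Gamma> k j l y * \<Gamma> l i k y))"

definition scalar_curv :: "('a, 'd::finite) spacetime \<Rightarrow> ('a, 'd) chart \<Rightarrow> 'a \<Rightarrow> real" where
  "scalar_curv M c x =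
     (\<Sum>i\<in>UNIV. \<Sum>j\<in>UNIV. matrix_inv (st_metric M c x) $ i $ j * ricci M c x $ i $ j)"

section \<open>Perfect fluids\<close>

definition perfect_fluid ::
  "('a, 'd::finite) spacetime \<Rightarrow> ('a, 'd) vfield \<Rightarrow> ('a \<Rightarrow> real) \<Rightarrow> ('a \<Rightarrow> real) \<Rightarrow> bool" where
  "perfect_fluid M u \<rho> p \<longleftrightarrow>
     vector_field (st_atlas M) u \<and> smooth_comps (st_atlas M) u \<and>
     (\<forall>c \<in> st_atlas M. \<forall>x \<in> cdom c. future_timelike M c x (u c x) \<and> ginner M c x (u c x) (u c x) = - 1) \<and>
     smooth_function (st_atlas M) \<rho> \<and> smooth_function (st_atlas M) p"

text \<open>Components of the one-form metrically equivalent to \<open>u\<close>.\<close>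

definition lower :: "('a, 'd::finite) spacetime \<Rightarrow> ('a, 'd) vfield \<Rightarrow> ('a, 'd) vfield" where
  "lower M u c x = (\<chi> i. ginner M c x (u c x) (axis i 1))"

definition einstein_perfect_fluid ::
  "('a, 'd::finite) spacetime \<Rightarrow> ('a, 'd) vfield \<Rightarrow> ('a \<Rightarrow> real) \<Rightarrow> ('a \<Rightarrow> real) \<Rightarrow> bool" where
  "einstein_perfect_fluid M u \<rho> p \<longleftrightarrow>
     (\<forall>c \<in> st_atlas M. \<forall>x \<in> cdom c. \<forall>i j.
        ricci M c x $ i $ j - 1/2 * scalar_curv M c x * st_metric M c x $ i $ j =
        8 * pi * ((\<rho> x + p x) * (lower M u c x $ i * lower M u c x $ j) + p x * st_metric M c x $ i $ j))"

section \<open>Integral curves and their past endpoints\<close>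

definition integral_curve ::
  "('a, 'd::finite) spacetime \<Rightarrow> ('a, 'd) vfield \<Rightarrow> (real \<Rightarrow> 'a) \<Rightarrow> real set \<Rightarrow> bool" where
  "integral_curve M u \<gamma> J \<longleftrightarrow> is_interval J \<and> interior J \<noteq> {} \<and>
     continuous_map (top_of_set J) (st_top M) \<gamma> \<and>
     (\<forall>t\<in>J. \<forall>c \<in> st_atlas M. \<gamma> t \<in> cdom c \<longrightarrow>
        ((crd c \<circ> \<gamma>) has_vector_derivative u c (\<gamma> t)) (at t within J))"

definition past_maximal_integral_curve ::
  "('a, 'd::finite) spacetime \<Rightarrow> ('a, 'd) vfield \<Rightarrow> (real \<Rightarrow> 'a) \<Rightarrow> real set \<Rightarrow> bool" where
  "past_maximal_integral_curve M u \<gamma> J \<longleftrightarrow> integral_curve M u \<gamma> J \<and>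
     (\<forall>\<gamma>' J'. integral_curve M u \<gamma>' J' \<and> J \<subseteq> J' \<and> (\<forall>t\<in>J. \<gamma>' t = \<gamma> t) \<longrightarrow>
        (\<forall>s\<in>J'. \<exists>t\<in>J. t \<le> s))"

definition with_past_endpoint :: "('a \<Rightarrow> 'b) \<Rightarrow> (real \<Rightarrow> 'a) \<Rightarrow> 'b \<Rightarrow> real \<Rightarrow> 'b" where
  "with_past_endpoint \<iota> \<gamma> q t = (if t = 0 then q else \<iota> (\<gamma> t))"

text \<open>The parameter is translated so that the domain begins at 0.\<close>

definition has_past_endpoint ::
  "('b, 'd::finite) spacetime \<Rightarrow> ('a \<Rightarrow> 'b) \<Rightarrow> (real \<Rightarrow> 'a) \<Rightarrow> real set \<Rightarrow> 'b \<Rightarrow> bool" where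
  "has_past_endpoint N \<iota> \<gamma> J q \<longleftrightarrow> bdd_below J \<and> Inf J \<notin> J \<and>
     continuous_map (top_of_set (insert 0 ((\<lambda>t. t - Inf J) ` J))) (st_top N)
       (with_past_endpoint \<iota> (\<lambda>t. \<gamma> (t + Inf J)) q)"

end

theory Submission imports Defs
begin

text \<open>Suppose \<open>\<rho> + p\<close> has a nonzero limit at \<open>\<O>\<close>. The Einstein equations then express the products
  \<open>u\<^sub>i u\<^sub>j\<close> through quantities that converge at \<open>\<O>\<close>, so in a chart around \<open>\<O>\<close> the direction of \<open>u\<close>
  converges to a fixed line. On the other hand every future timelike vector \<open>w\<close> at \<open>\<O>\<close> gives short
  timelike coordinate segments from \<open>\<O>\<close>, whose points lie in \<open>M\<close>; choose \<open>w\<close> off the limit line, which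
  is possible in dimension at least 2. The integral curve of \<open>u\<close> through such a point, followed to the
  past, ends at \<open>\<O>\<close> and by strong causality never leaves a small neighbourhood of \<open>\<O>\<close>. Its tangent
  therefore stays in a narrow cone around the limit line, and by Cauchy's mean value theorem so does
  the chord, which is a multiple of \<open>w\<close>: a contradiction.\<close>

section \<open>Charts\<close>

text \<open>The field equations control \<open>u\<close> only through products of its components and
  leave its sign open, so the cone condition has the sign-free form |v_j - r_j v_k| <= eps |v_k|.
  Two facts make the products useful. The metric at \<O> is Lorentzian, hence invertible, so the
  scalar curvature converges and indices can be raised in the limit; and g(u,u) = -1 prevents the
  limit of the products from being zero. That both ends lie near \<O> does not by itself keep a flow
  line inside a chart. Hypothesis (b) makes the extended line a timelike, hence causal curve, and
  only then does strong causality confine it. This dictates the order of choices: the limit line, a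
  timelike w off it, a cone width excluding w, a neighbourhood where the cone estimate holds with
  that width, the smaller neighbourhood given by strong causality, and last the length of the
  segment, whose end must lie in the smaller one. Hypothesis (b) speaks of curves that are maximal
  to the past, so such curves have to be constructed.\<close>

lemma frechet_derivative_cong_open:
  assumes "open S" "x \<in> S" and eq: "\<And>y. y \<in> S \<Longrightarrow> f y = g y"
  shows "frechet_derivative f (at x) = frechet_derivative g (at x)"
proof -
  have "(f has_derivative D) (at x) \<longleftrightarrow> (g has_derivative D) (at x)" for D
    using assms has_derivative_transform_within_open[of f D x UNIV S g]
      has_derivative_transform_within_open[of g D x UNIV S f] by auto
  then show ?thesis unfolding frechet_derivative_def by simp
qed

lemma Ck_on_cong:
  assumes "open S" and "\<And>y. y \<in> S \<Longrightarrow> f y = g y" and "Ck_on k S f"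
  shows "Ck_on k S g"
  using assms(2,3)
proof (induction k arbitrary: f g)
  case 0
  then show ?case by (simp cong: continuous_on_cong)
next
  case (Suc k)
  have "g differentiable (at x)" if "x \<in> S" for x
    using Suc.prems that \<open>open S\<close> has_derivative_transform_within_open
    unfolding differentiable_def by (metis Ck_on.simps(2) differentiable_def)
  moreover have "Ck_on k S (\<lambda>x. frechet_derivative g (at x) v)" for v
  proof (rule Suc.IH)
    show "Ck_on k S (\<lambda>x. frechet_derivative f (at x) v)" using Suc.prems(2) by simp
    show "frechet_derivative f (at y) v = frechet_derivative g (at y) v" if "y \<in> S" for y
      using frechet_derivative_cong_open[OF \<open>open S\<close> that Suc.prems(1)] by simp
  qed
  ultimately show ?case by simp
qed

lemma smooth_on_cong:
  assumes "open S" and "\<And>y. y \<in> S \<Longrightarrow> f y = g y" and "smooth_on S f"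
  shows "smooth_on S g"
  using assms Ck_on_cong[OF assms(1), of f g] unfolding smooth_on_def by blast

lemma smooth_on_imp_continuous_on: "smooth_on S f \<Longrightarrow> continuous_on S f"
  unfolding smooth_on_def using Ck_on.simps(1) by blast

lemma smooth_on_imp_differentiable: "smooth_on S f \<Longrightarrow> x \<in> S \<Longrightarrow> f differentiable (at x)"
  unfolding smooth_on_def using Ck_on.simps(2) by blast

lemma smooth_on_imp_continuous_deriv:
  "smooth_on S f \<Longrightarrow> continuous_on S (\<lambda>x. frechet_derivative f (at x) v)"
  unfolding smooth_on_def using Ck_on.simps by blast

lemma is_chartD:
  assumes "is_chart T c"
  shows chart_inj_on: "inj_on (crd c) (cdom c)"
    and chart_dom_subset: "cdom c \<subseteq> topspace T"
    and chart_open_dom: "openin T (cdom c)"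
    and chart_open_range: "open (crd c ` cdom c)"
    and chart_continuous_crd: "continuous_map (subtopology T (cdom c)) euclidean (crd c)"
proof -
  have o: "openin T (cdom c)" "open (crd c ` cdom c)"
    and h: "homeomorphic_map (subtopology T (cdom c)) (top_of_set (crd c ` cdom c)) (crd c)"
    using assms unfolding is_chart_def by auto
  show "openin T (cdom c)" "open (crd c ` cdom c)" using o by auto
  show s: "cdom c \<subseteq> topspace T" using o openin_subset by auto
  show "inj_on (crd c) (cdom c)"
    using homeomorphic_imp_injective_map[OF h] s by (simp add: Int_absorb1)
  show "continuous_map (subtopology T (cdom c)) euclidean (crd c)"
    using homeomorphic_imp_continuous_map[OF h] by (simp add: continuous_map_in_subtopology)
qed

lemma cinv_crd: "is_chart T c \<Longrightarrow> x \<in> cdom c \<Longrightarrow> cinv c (crd c x) = x"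
  unfolding cinv_def using chart_inj_on by (metis inv_into_f_f)

lemma crd_cinv: "y \<in> crd c ` cdom c \<Longrightarrow> crd c (cinv c y) = y"
  unfolding cinv_def by (simp add: f_inv_into_f)

lemma cinv_in_dom: "y \<in> crd c ` cdom c \<Longrightarrow> cinv c y \<in> cdom c"
  unfolding cinv_def by (simp add: inv_into_into)

lemma chart_open_image:
  assumes c: "is_chart T c" and W: "openin T W" "W \<subseteq> cdom c"
  shows "open (crd c ` W)"
proof -
  have h: "homeomorphic_map (subtopology T (cdom c)) (top_of_set (crd c ` cdom c)) (crd c)"
    using c unfolding is_chart_def by auto
  have "openin (subtopology T (cdom c)) W"
    using W by (simp add: chart_open_dom[OF c] openin_open_subtopology)
  then have "openin (top_of_set (crd c ` cdom c)) (crd c ` W)"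
    using homeomorphic_imp_open_map[OF h] unfolding open_map_def by auto
  then show ?thesis using openin_open_eq[OF chart_open_range[OF c]] by auto
qed

lemma chart_open_preimage:
  assumes c: "is_chart T c" and "open Y"
  shows "openin T {x \<in> cdom c. crd c x \<in> Y}"
proof -
  have "openin (subtopology T (cdom c)) {x \<in> topspace (subtopology T (cdom c)). crd c x \<in> Y}"
    using chart_continuous_crd[OF c] \<open>open Y\<close> openin_continuous_map_preimage by fastforce
  then show ?thesis
    using chart_dom_subset[OF c]
    by (simp add: chart_open_dom[OF c] openin_open_subtopology Int_absorb1)
qed

lemma chart_continuous_cinv:
  assumes c: "is_chart T c"
  shows "continuous_map (top_of_set (crd c ` cdom c)) T (cinv c)"
proof -
  obtain g where g: "homeomorphic_maps (subtopology T (cdom c)) (top_of_set (crd c ` cdom c)) (crd c) g"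
    using c unfolding is_chart_def homeomorphic_map_maps by auto
  have "continuous_map (top_of_set (crd c ` cdom c)) (subtopology T (cdom c)) g"
    using g unfolding homeomorphic_maps_def by auto
  moreover have "g y = cinv c y" if y: "y \<in> crd c ` cdom c" for y
  proof -
    obtain x where x: "x \<in> cdom c" "y = crd c x" using y by blast
    have "g (crd c x) = x"
      using g x(1) chart_dom_subset[OF c] by (simp add: homeomorphic_maps_def Int_absorb1)
    then show ?thesis using x cinv_crd[OF c] by simp
  qed
  ultimately have "continuous_map (top_of_set (crd c ` cdom c)) (subtopology T (cdom c)) (cinv c)"
    using continuous_map_eq[of "top_of_set (crd c ` cdom c)" _ g "cinv c"] by simp
  then show ?thesis by (simp add: continuous_map_in_subtopology)
qed

lemma smooth_manifoldD:
  assumes "smooth_manifold T A" "c \<in> A"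
  shows manifold_chart: "is_chart T c"
    and manifold_compatible: "c' \<in> A \<Longrightarrow> smoothly_compatible c c'"
  using assms unfolding smooth_manifold_def by blast+

lemma manifold_cover: "smooth_manifold T A \<Longrightarrow> x \<in> topspace T \<Longrightarrow> \<exists>c\<in>A. x \<in> cdom c"
  unfolding smooth_manifold_def by blast

lemma chart_overlap_open:
  assumes "smooth_manifold T A" "c \<in> A" "c' \<in> A"
  shows "open (crd c ` (cdom c \<inter> cdom c'))"
  using assms by (intro chart_open_image[of T]) (auto intro: manifold_chart chart_open_dom)

text \<open>Compatibility makes the transition map differentiable on the overlap, so the matrix in
  \<open>jac\<close> represents a genuine derivative and not an arbitrary choice. Every later change
  of chart rests on this.\<close>

lemma jac_has_derivative:
  assumes A: "smooth_manifold T A" "c \<in> A" "c' \<in> A" and x: "x \<in> cdom c \<inter> cdom c'"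
  shows "(crd c' \<circ> cinv c has_derivative (\<lambda>v. jac c id c' x *v v)) (at (crd c x))"
proof -
  have "smooth_on (crd c ` (cdom c \<inter> cdom c')) (crd c' \<circ> cinv c)"
    using manifold_compatible[OF A(1,2,3)] unfolding smoothly_compatible_def by auto
  then have d: "(crd c' \<circ> cinv c) differentiable (at (crd c x))"
    using smooth_on_imp_differentiable x by blast
  have "jac c id c' x *v v = frechet_derivative (crd c' \<circ> cinv c) (at (crd c x)) v" for v
    unfolding jac_def using linear_frechet_derivative[OF d]
    by (simp add: matrix_works)
  then show ?thesis using d frechet_derivative_works by (metis (no_types, lifting) ext)
qed

section \<open>Charts of the extension pulled back along the embedding\<close>

lemma pull_chart_sel [simp]:
  "cdom (pull_chart M \<iota> c) = pts M \<inter> \<iota> -` cdom c" "crd (pull_chart M \<iota> c) = crd c \<circ> \<iota>"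
  by (simp_all add: pull_chart_def)

text \<open>The pulled-back coordinates are a composition of two restricted homeomorphisms, \<iota>
  onto its image and \<open>crd c\<close> on the part of that image inside the chart. Openness of
  the image makes the coordinate range open.\<close>

lemma pull_chart_is_chart:
  assumes emb: "embedding_map (st_top M) T \<iota>" and op: "openin T (\<iota> ` pts M)" and c: "is_chart T c"
  shows "is_chart (st_top M) (pull_chart M \<iota> c)"
proof -
  let ?D = "pts M \<inter> \<iota> -` cdom c"
  have h: "homeomorphic_map (st_top M) (subtopology T (\<iota> ` pts M)) \<iota>"
    using emb by (simp add: embedding_map_def)
  have cont: "continuous_map (st_top M) T \<iota>"
    using homeomorphic_imp_continuous_map[OF h] by (simp add: continuous_map_in_subtopology)
  have D: "openin (st_top M) ?D"
    using openin_continuous_map_preimage[OF cont chart_open_dom[OF c]]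
    by (simp add: vimage_def Collect_conj_eq)
  let ?W = "\<iota> ` pts M \<inter> cdom c"
  have W: "openin T ?W" using op chart_open_dom[OF c] by auto
  have im: "\<iota> ` ?D = ?W" by auto
  have img: "(crd c \<circ> \<iota>) ` ?D = crd c ` ?W" by (metis im image_comp)
  have h1: "homeomorphic_map (subtopology (st_top M) ?D) (subtopology T ?W) \<iota>"
  proof -
    have "homeomorphic_map (subtopology (st_top M) ?D) (subtopology (subtopology T (\<iota> ` pts M)) ?W) \<iota>"
      by (rule homeomorphic_map_subtopologies[OF h])
        (use openin_subset[OF W] in \<open>auto\<close>)
    then show ?thesis by (simp add: subtopology_subtopology Int_absorb1)
  qed
  have h2: "homeomorphic_map (subtopology T ?W) (top_of_set (crd c ` ?W)) (crd c)"
  proof -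
    have hc: "homeomorphic_map (subtopology T (cdom c)) (top_of_set (crd c ` cdom c)) (crd c)"
      using c unfolding is_chart_def by auto
    have "homeomorphic_map (subtopology (subtopology T (cdom c)) ?W)
        (subtopology (top_of_set (crd c ` cdom c)) (crd c ` ?W)) (crd c)"
      by (rule homeomorphic_map_subtopologies[OF hc]) (use openin_subset[OF W] in auto)
    moreover have "cdom c \<inter> ?W = ?W" "crd c ` cdom c \<inter> crd c ` ?W = crd c ` ?W" by auto
    ultimately show ?thesis by (simp add: subtopology_subtopology)
  qed
  have "homeomorphic_map (subtopology (st_top M) ?D) (top_of_set (crd c ` ?W)) (crd c \<circ> \<iota>)"
    using homeomorphic_map_compose[OF h1 h2] .
  moreover have "open (crd c ` ?W)" by (rule chart_open_image[OF c W]) auto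
  ultimately show ?thesis unfolding is_chart_def pull_chart_sel img using D by auto
qed

lemma cinv_pull_chart:
  assumes "is_chart (st_top M) (pull_chart M \<iota> c)" "is_chart T c" "inj_on \<iota> (pts M)"
    and x: "x \<in> pts M" "\<iota> x \<in> cdom c"
  shows "cinv (pull_chart M \<iota> c) (crd c (\<iota> x)) = x"
    and "inv_into (pts M) \<iota> (cinv c (crd c (\<iota> x))) = x"
proof -
  show "cinv (pull_chart M \<iota> c) (crd c (\<iota> x)) = x"
    using cinv_crd[OF assms(1), of x] x by simp
  show "inv_into (pts M) \<iota> (cinv c (crd c (\<iota> x))) = x"
    using cinv_crd[OF assms(2) x(2)] assms(3) x(1) by (simp add: inv_into_f_f)
qed

text \<open>Since the atlas is maximal, compatibility with all its charts is enough. Once the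
  overlaps are rewritten, the two compatibility conditions are the two smoothness clauses of
  \<open>smooth_embedding\<close>.\<close>

lemma pull_chart_in_atlas:
  assumes M: "smooth_manifold (st_top M) (st_atlas M)" and N: "smooth_manifold (st_top N) (st_atlas N)"
    and emb: "smooth_embedding M N \<iota>" and c: "c \<in> st_atlas N"
  shows "pull_chart M \<iota> c \<in> st_atlas M"
proof -
  let ?P = "pull_chart M \<iota> c"
  have cN: "is_chart (st_top N) c" using manifold_chart[OF N c] .
  have E: "embedding_map (st_top M) (st_top N) \<iota>" "openin (st_top N) (\<iota> ` pts M)"
    using emb unfolding smooth_embedding_def by auto
  have P: "is_chart (st_top M) ?P" using pull_chart_is_chart[OF E cN] .
  have inj: "inj_on \<iota> (pts M)"
    using E(1) embedding_map_def homeomorphic_imp_injective_map by blast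
  have "smoothly_compatible ?P c'" if c': "c' \<in> st_atlas M" for c'
  proof -
    have c'M: "is_chart (st_top M) c'" using manifold_chart[OF M c'] .
    note sub = chart_dom_subset[OF c'M]
    have s1: "smooth_on (crd c' ` (cdom c' \<inter> \<iota> -` cdom c)) (crd c \<circ> \<iota> \<circ> cinv c')"
      and s2: "smooth_on (crd c ` (\<iota> ` cdom c' \<inter> cdom c)) (crd c' \<circ> inv_into (pts M) \<iota> \<circ> cinv c)"
      using emb c c' unfolding smooth_embedding_def by auto
    have set1: "cdom ?P \<inter> cdom c' = cdom c' \<inter> \<iota> -` cdom c" using sub by auto
    have set2: "crd ?P ` (cdom ?P \<inter> cdom c') = crd c ` (\<iota> ` cdom c' \<inter> cdom c)"
      using sub by (auto simp: image_iff)
    have op: "open (crd ?P ` (cdom ?P \<inter> cdom c'))"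
      by (rule chart_open_image[OF P]) (use P c'M chart_open_dom in blast)+
    have "smooth_on (crd ?P ` (cdom ?P \<inter> cdom c')) (crd c' \<circ> cinv ?P)"
      by (rule smooth_on_cong[OF op _ s2[folded set2]])
        (auto simp: cinv_pull_chart[OF P cN inj])
    then show ?thesis
      unfolding smoothly_compatible_def Int_commute[of "cdom ?P"]
      using s1 set1 by (simp add: comp_assoc Int_commute)
  qed
  then show ?thesis using M P unfolding smooth_manifold_def by blast
qed

text \<open>Read in the charts \<open>pull_chart M \<iota> c\<close> and \<open>c\<close>, the map
  \<iota> is the identity, so its Jacobian is the unit matrix. This lets the metric of
  \<open>M\<close> be replaced by that of \<open>N\<close>, which is continuous up to the boundary
  point.\<close>

lemma pull_chart_metric:
  assumes M: "smooth_manifold (st_top M) (st_atlas M)" and N: "smooth_manifold (st_top N) (st_atlas N)"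
    and iso: "isometric_embedding M N \<iota>" and c: "c \<in> st_atlas N" and x: "x \<in> pts M" "\<iota> x \<in> cdom c"
  shows "st_metric M (pull_chart M \<iota> c) x = st_metric N c (\<iota> x)"
proof -
  let ?P = "pull_chart M \<iota> c"
  have emb: "smooth_embedding M N \<iota>" using iso unfolding isometric_embedding_def by auto
  have PA: "?P \<in> st_atlas M" using pull_chart_in_atlas[OF M N emb c] .
  have P: "is_chart (st_top M) ?P" using manifold_chart[OF M PA] .
  have id: "(crd c \<circ> \<iota> \<circ> cinv ?P) y = id y" if "y \<in> crd ?P ` cdom ?P" for y
    using crd_cinv[OF that] by simp
  have "frechet_derivative (crd c \<circ> \<iota> \<circ> cinv ?P) (at (crd ?P x)) = frechet_derivative id (at (crd ?P x))"
    by (rule frechet_derivative_cong_open[OF chart_open_range[OF P] _ id]) (use x in auto)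
  also have "\<dots> = id" by (metis frechet_derivative_at has_derivative_id eq_id_iff id_def)
  finally have "jac ?P \<iota> c x = mat 1" unfolding jac_def by (simp add: matrix_id_mat_1)
  moreover have "st_metric M ?P x = transpose (jac ?P \<iota> c x) ** st_metric N c (\<iota> x) ** jac ?P \<iota> c x"
    using iso PA c x unfolding isometric_embedding_def by auto
  ultimately show ?thesis by (simp add: transpose_mat)
qed

section \<open>Existence of integral curves\<close>

text \<open>Banach's fixed point theorem for the Picard operator on bounded continuous functions;
  \<open>h * L < 1\<close> makes it a contraction in the supremum distance.\<close>

lemma picard_lindelof_global:
  fixes V :: "'a::euclidean_space \<Rightarrow> 'a"
  assumes lip: "\<And>x y. dist (V x) (V y) \<le> L * dist x y" and "0 \<le> L" "0 < h" "h * L < 1"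
  obtains f where "f 0 = y0"
    and "\<And>t. t \<in> {0..h} \<Longrightarrow> (f has_vector_derivative V (f t)) (at t within {0..h})"
proof -
  \<comment> \<open>Clamping time to \<open>{0..h}\<close> makes each Picard iterate bounded on the
    whole real line, so the complete space \<open>bcontfun\<close> can be used; on
    \<open>{0..h}\<close> the clamp is the identity.\<close>
  define k where "k t = max 0 (min h t)" for t :: real
  have k: "k t \<in> {0..h}" for t using \<open>0 < h\<close> by (auto simp: k_def)
  have k_cont: "continuous_on UNIV k" unfolding k_def by (intro continuous_intros)
  have V_cont: "continuous_on UNIV V"
    by (rule lipschitz_on_continuous_on[of L]) (use lip \<open>0 \<le> L\<close> in \<open>auto intro: lipschitz_onI\<close>)
  have Vf_cont: "continuous_on S (\<lambda>s. V (apply_bcontfun f s))" for f and S :: "real set"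
    by (rule continuous_on_compose2[OF V_cont]) auto
  define P where "P f t = y0 + integral {0..k t} (\<lambda>s. V (apply_bcontfun f s))" for f t
  have P_bc: "P f \<in> bcontfun" for f
  proof -
    let ?g = "\<lambda>t. y0 + integral {0..t} (\<lambda>s. V (apply_bcontfun f s))"
    have g: "continuous_on {0..h} ?g"
      by (intro continuous_intros indefinite_integral_continuous_1 integrable_continuous_real Vf_cont)
    have "continuous_on UNIV (P f)"
      unfolding P_def using k by (intro continuous_on_compose2[OF g k_cont]) auto
    moreover have "range (P f) \<subseteq> ?g ` {0..h}" unfolding P_def using k by blast
    then have "bounded (range (P f))"
      using compact_imp_bounded[OF compact_continuous_image[OF g]] bounded_subset by blast
    ultimately show ?thesis by (simp add: bcontfun_def)
  qed
  have contr: "dist (Bcontfun (P f)) (Bcontfun (P g)) \<le> (h * L) * dist f g" for f g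
  proof (rule dist_bound)
    fix t
    have int: "(\<lambda>s. V (apply_bcontfun f s)) integrable_on {0..k t}" for f
      by (rule integrable_continuous_real[OF Vf_cont])
    have "dist (P f t) (P g t)
        = norm (integral {0..k t} (\<lambda>s. V (apply_bcontfun f s) - V (apply_bcontfun g s)))"
      unfolding P_def by (simp add: dist_norm integral_diff[OF int int])
    also have "\<dots> \<le> (L * dist f g) * (k t - 0)"
    proof (rule integral_bound)
      show "norm (V (apply_bcontfun f s) - V (apply_bcontfun g s)) \<le> L * dist f g" for s
        using lip[of "apply_bcontfun f s" "apply_bcontfun g s"] dist_bounded[of f s g] \<open>0 \<le> L\<close>
        by (smt (verit) dist_norm mult_left_mono)
    qed (use k[of t] in \<open>auto intro!: continuous_intros Vf_cont\<close>)
    also have "\<dots> \<le> (L * dist f g) * h"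
      using k[of t] \<open>0 \<le> L\<close> by (intro mult_left_mono) auto
    finally show "dist (apply_bcontfun (Bcontfun (P f)) t) (apply_bcontfun (Bcontfun (P g)) t) \<le> h * L * dist f g"
      by (simp add: Bcontfun_inverse P_bc mult_ac)
  qed
  obtain f where f: "Bcontfun (P f) = f"
    using banach_fix_type[of "h * L" "\<lambda>f. Bcontfun (P f)"] contr assms by auto
  have feq: "apply_bcontfun f t = P f t" for t
    by (metis Bcontfun_inverse P_bc f)
  show ?thesis
  proof
    have "k 0 = 0" using \<open>0 < h\<close> by (simp add: k_def)
    then show "apply_bcontfun f 0 = y0" unfolding feq[of 0] P_def by simp
    show "(apply_bcontfun f has_vector_derivative V (apply_bcontfun f t)) (at t within {0..h})"
      if t: "t \<in> {0..h}" for t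
    proof -
      have "((\<lambda>t. y0 + integral {0..t} (\<lambda>s. V (apply_bcontfun f s))) has_vector_derivative
          0 + V (apply_bcontfun f t)) (at t within {0..h})"
        by (intro derivative_intros integral_has_vector_derivative[OF Vf_cont t])
      moreover have "apply_bcontfun f s = y0 + integral {0..s} (\<lambda>s. V (apply_bcontfun f s))"
        if "s \<in> {0..h}" for s
      proof -
        have "k s = s" using that by (auto simp: k_def)
        then show ?thesis using feq[of s] by (simp add: P_def)
      qed
      ultimately show ?thesis using t
        by (auto intro: has_vector_derivative_transform)
    qed
  qed
qed

text \<open>Composing \<open>X\<close> with the nearest-point projection onto the ball, which does
  not increase distances, gives a globally Lipschitz field. By continuity its solution stays in the
  ball for a short time, and there the projection changes nothing.\<close>

lemma picard_lindelof_local: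
  fixes X :: "'a::euclidean_space \<Rightarrow> 'a"
  assumes lip: "\<And>x y. x \<in> cball y0 r \<Longrightarrow> y \<in> cball y0 r \<Longrightarrow> dist (X x) (X y) \<le> L * dist x y"
    and "0 < r" "0 \<le> L"
  obtains h f where "0 < h" "f 0 = y0" "f ` {0..h} \<subseteq> cball y0 r"
    and "\<And>t. t \<in> {0..h} \<Longrightarrow> (f has_vector_derivative X (f t)) (at t within {0..h})"
proof -
  let ?K = "cball y0 r"
  have K: "convex ?K" "closed ?K" "?K \<noteq> {}" using \<open>0 < r\<close> by auto
  define V where "V x = X (closest_point ?K x)" for x
  have V_lip: "dist (V x) (V y) \<le> L * dist x y" for x y
  proof -
    have "dist (V x) (V y) \<le> L * dist (closest_point ?K x) (closest_point ?K y)"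
      unfolding V_def using K by (intro lip closest_point_in_set)
    also have "\<dots> \<le> L * dist x y"
      using closest_point_lipschitz[OF K] \<open>0 \<le> L\<close> by (intro mult_left_mono)
    finally show ?thesis .
  qed
  define h1 where "h1 = 1 / (L + 1)"
  have h1: "0 < h1" "h1 * L < 1" using \<open>0 \<le> L\<close> by (auto simp: h1_def field_simps)
  obtain f where f: "f 0 = y0"
    "\<And>t. t \<in> {0..h1} \<Longrightarrow> (f has_vector_derivative V (f t)) (at t within {0..h1})"
    using picard_lindelof_global[OF V_lip \<open>0 \<le> L\<close> h1] by blast
  have "continuous_on {0..h1} f"
    by (rule continuous_on_vector_derivative[where f' = "\<lambda>t. V (f t)"]) (rule f(2))
  then obtain d where d: "d > 0" "\<And>t. t \<in> {0..h1} \<Longrightarrow> dist t 0 < d \<Longrightarrow> dist (f t) (f 0) < r"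
    using \<open>0 < r\<close> h1(1) unfolding continuous_on_iff by fastforce
  define h where "h = min h1 (d / 2)"
  have h: "0 < h" "h \<le> h1" "h < d" using d(1) h1(1) by (auto simp: h_def)
  have im: "f t \<in> ?K" if "t \<in> {0..h}" for t
    using d(2)[of t] that h f(1) by (auto simp: dist_commute)
  have "(f has_vector_derivative X (f t)) (at t within {0..h})" if "t \<in> {0..h}" for t
  proof -
    have "V (f t) = X (f t)" using im[OF that] by (simp add: V_def closest_point_self)
    then show ?thesis
      using f(2)[of t] that h has_vector_derivative_within_subset[of f "V (f t)" t "{0..h1}" "{0..h}"]
      by auto
  qed
  then show ?thesis using that[of h f, OF h(1) f(1)] im by blast
qed

text \<open>Continuity of the derivative is given one direction at a time, so compactness yields a
  bound for each basis vector. The sum of these bounds dominates the operator norm, and the mean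
  value inequality on the convex ball finishes.\<close>

lemma C1_imp_lipschitz_cball:
  fixes X :: "'a::euclidean_space \<Rightarrow> 'b::real_normed_vector"
  assumes diff: "\<And>x. x \<in> cball y0 r \<Longrightarrow> X differentiable (at x)"
    and cont: "\<And>v. continuous_on (cball y0 r) (\<lambda>x. frechet_derivative X (at x) v)"
  obtains L where "0 \<le> L"
    "\<And>x y. x \<in> cball y0 r \<Longrightarrow> y \<in> cball y0 r \<Longrightarrow> dist (X x) (X y) \<le> L * dist x y"
proof -
  let ?K = "cball y0 r" and ?D = "\<lambda>x. frechet_derivative X (at x)"
  have "\<exists>B. \<forall>x\<in>?K. norm (?D x b) \<le> B" for b
    using compact_imp_bounded[OF compact_continuous_image[OF cont[of b] compact_cball]]
    by (auto simp: bounded_iff)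
  then obtain B where B: "\<And>b x. x \<in> ?K \<Longrightarrow> norm (?D x b) \<le> B b" by metis
  define L where "L = (\<Sum>b\<in>Basis. \<bar>B b\<bar>)"
  have on: "onorm (?D x) \<le> L" if x: "x \<in> ?K" for x
  proof (rule onorm_le)
    fix v
    have lin: "linear (?D x)" using linear_frechet_derivative[OF diff[OF x]] .
    have "norm (?D x v) = norm (\<Sum>b\<in>Basis. (v \<bullet> b) *\<^sub>R ?D x b)"
      by (subst euclidean_representation[of v, symmetric])
        (simp add: linear_sum[OF lin] linear_scale[OF lin])
    also have "\<dots> \<le> (\<Sum>b\<in>Basis. \<bar>B b\<bar> * norm v)"
    proof (rule sum_norm_le)
      fix b :: 'a assume b: "b \<in> Basis"
      have "\<bar>v \<bullet> b\<bar> \<le> norm v" using Basis_le_norm[OF b] .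
      moreover have "norm (?D x b) \<le> \<bar>B b\<bar>" using B[OF x, of b] by auto
      ultimately show "norm ((v \<bullet> b) *\<^sub>R ?D x b) \<le> \<bar>B b\<bar> * norm v"
        using mult_mono[of "\<bar>v \<bullet> b\<bar>" "norm v" "norm (?D x b)" "\<bar>B b\<bar>"] by (simp add: mult_ac)
    qed
    also have "\<dots> = L * norm v" unfolding L_def by (simp add: sum_distrib_right)
    finally show "norm (?D x v) \<le> L * norm v" .
  qed
  have der: "(X has_derivative ?D z) (at z within ?K)" if "z \<in> ?K" for z
    using has_derivative_at_withinI[OF frechet_derivative_works[THEN iffD1, OF diff[OF that]]] .
  have "norm (X x - X y) \<le> L * norm (x - y)" if "x \<in> ?K" "y \<in> ?K" for x y
    by (rule differentiable_bound[OF convex_cball der on that])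
  moreover have "0 \<le> L" unfolding L_def by (simp add: sum_nonneg)
  ultimately show ?thesis using that by (simp add: dist_norm)
qed

section \<open>Restricting and gluing integral curves\<close>

lemma continuous_map_localI:
  assumes loc: "\<And>t. t \<in> J \<Longrightarrow> \<exists>K W f. open W \<and> t \<in> W \<and> J \<inter> W \<subseteq> K \<and> t \<in> K \<and> 
      continuous_map (top_of_set K) T f \<and> (\<forall>s\<in>J \<inter> W. g s = f s)"
  shows "continuous_map (top_of_set J) T g"
  unfolding continuous_map
proof (intro conjI allI impI)
  show "g ` topspace (top_of_set J) \<subseteq> topspace T"
  proof (clarsimp)
    fix t assume t: "t \<in> J"
    then show "g t \<in> topspace T"
      using loc[OF t] unfolding continuous_map by fastforce
  qed
  fix U assume U: "openin T U"
  show "openin (top_of_set J) {x \<in> topspace (top_of_set J). g x \<in> U}"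
  proof (subst openin_subopen, clarsimp)
    fix t assume t: "t \<in> J" "g t \<in> U"
    obtain K W f where *: "open W" "t \<in> W" "J \<inter> W \<subseteq> K" "t \<in> K"
      "continuous_map (top_of_set K) T f" "\<And>s. s \<in> J \<inter> W \<Longrightarrow> g s = f s"
      using loc[OF t(1)] by blast
    have "openin (top_of_set K) {x \<in> K. f x \<in> U}"
      using *(5) U unfolding continuous_map by auto
    then obtain Q where Q: "open Q" "{x \<in> K. f x \<in> U} = K \<inter> Q" by (auto simp: openin_open)
    have "openin (top_of_set J) (J \<inter> (W \<inter> Q))" using *(1) Q(1) by (auto simp: openin_open)
    moreover have "t \<in> J \<inter> (W \<inter> Q)" using t * Q(2) by auto
    moreover have "g s \<in> U" if "s \<in> J \<inter> (W \<inter> Q)" for s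
    proof -
      have "s \<in> {x \<in> K. f x \<in> U}" using that *(3) unfolding Q(2) by blast
      then show ?thesis using *(6)[of s] that by simp
    qed
    then have "J \<inter> (W \<inter> Q) \<subseteq> {x \<in> J. g x \<in> U}" by blast
    ultimately show "\<exists>T. openin (top_of_set J) T \<and> t \<in> T \<and> T \<subseteq> {x \<in> J. g x \<in> U}" by blast
  qed
qed

lemma integral_curve_subset:
  assumes "integral_curve M u \<gamma> J" "K \<subseteq> J" "is_interval K" "interior K \<noteq> {}"
  shows "integral_curve M u \<gamma> K"
  unfolding integral_curve_def
proof (intro conjI ballI impI)
  show "continuous_map (top_of_set K) (st_top M) \<gamma>"
    using assms continuous_map_from_subtopology_mono unfolding integral_curve_def by blast
  show "((crd c \<circ> \<gamma>) has_vector_derivative u c (\<gamma> t)) (at t within K)"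
    if "t \<in> K" "c \<in> st_atlas M" "\<gamma> t \<in> cdom c" for t c
    using assms(1,2) that unfolding integral_curve_def
    by (intro has_vector_derivative_within_subset[where S = J and T = K]) blast+
qed (use assms in auto)

text \<open>A piece \<open>K\<close> contains all of \<open>J\<close> near t, so derivatives within
  \<open>K\<close> and within \<open>J\<close> agree at t. This is what allows the union of a chain
  of curves to be recognised as an integral curve.\<close>

lemma integral_curve_localI:
  assumes J: "is_interval J" "interior J \<noteq> {}"
    and loc: "\<And>t. t \<in> J \<Longrightarrow> \<exists>K W f. open W \<and> t \<in> W \<and> J \<inter> W \<subseteq> K \<and> K \<subseteq> J \<and>
      integral_curve M u f K \<and> (\<forall>s\<in>K. \<gamma> s = f s)"
  shows "integral_curve M u \<gamma> J"
proof -
  have "continuous_map (top_of_set J) (st_top M) \<gamma>"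
  proof (rule continuous_map_localI)
    fix t assume "t \<in> J"
    then obtain K W f where "open W" "t \<in> W" "J \<inter> W \<subseteq> K" "K \<subseteq> J" "integral_curve M u f K"
      "\<forall>s\<in>K. \<gamma> s = f s"
      using loc by meson
    then show "\<exists>K W f. open W \<and> t \<in> W \<and> J \<inter> W \<subseteq> K \<and> t \<in> K \<and> 
        continuous_map (top_of_set K) (st_top M) f \<and> (\<forall>s\<in>J \<inter> W. \<gamma> s = f s)"
      using \<open>t \<in> J\<close> unfolding integral_curve_def by blast
  qed
  moreover have "((crd c \<circ> \<gamma>) has_vector_derivative u c (\<gamma> t)) (at t within J)"
    if t: "t \<in> J" and c: "c \<in> st_atlas M" "\<gamma> t \<in> cdom c" for t c
  proof -
    obtain K W f where *: "open W" "t \<in> W" "J \<inter> W \<subseteq> K" "K \<subseteq> J" "integral_curve M u f K"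
      "\<forall>s\<in>K. \<gamma> s = f s"
      using loc[OF t] by meson
    have tK: "t \<in> K" using * t by auto
    have "((crd c \<circ> f) has_vector_derivative u c (f t)) (at t within K)"
      using * tK c unfolding integral_curve_def by auto
    then have "((crd c \<circ> \<gamma>) has_vector_derivative u c (\<gamma> t)) (at t within K)"
      using has_vector_derivative_transform[OF tK, of "crd c \<circ> \<gamma>" "crd c \<circ> f" "u c (f t)"] * tK
      by simp
    moreover have "at t within J = at t within K"
      using * by (intro at_within_nhd[of t W]) auto
    ultimately show ?thesis by simp
  qed
  ultimately show ?thesis using J unfolding integral_curve_def by auto
qed

text \<open>The coordinate equation is solved forward for the reversed field and time is then
  reversed. The equation in any other chart follows from the transformation law of vector
  fields.\<close>

lemma past_integral_curve_exists:
  assumes M: "smooth_manifold (st_top M) (st_atlas M)"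
    and u: "vector_field (st_atlas M) u" "smooth_comps (st_atlas M) u" and x: "x \<in> pts M"
  obtains h \<gamma> where "0 < h" "integral_curve M u \<gamma> {-h..0}" "\<gamma> 0 = x"
proof -
  obtain c where c: "c \<in> st_atlas M" "x \<in> cdom c" using manifold_cover[OF M x] by blast
  have ch: "is_chart (st_top M) c" using manifold_chart[OF M c(1)] .
  let ?S = "crd c ` cdom c" and ?X = "u c \<circ> cinv c"
  have X: "smooth_on ?S ?X" using u(2) c(1) unfolding smooth_comps_def by auto
  obtain r where r: "r > 0" "cball (crd c x) r \<subseteq> ?S"
    using chart_open_range[OF ch] c(2) open_contains_cball by blast
  obtain L where L: "0 \<le> L" "\<And>y z. y \<in> cball (crd c x) r \<Longrightarrow> z \<in> cball (crd c x) r \<Longrightarrow>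
      dist (?X y) (?X z) \<le> L * dist y z"
  proof (rule C1_imp_lipschitz_cball[of "crd c x" r ?X])
    show "?X differentiable (at y)" if "y \<in> cball (crd c x) r" for y
      using smooth_on_imp_differentiable[OF X] r that by auto
    show "continuous_on (cball (crd c x) r) (\<lambda>y. frechet_derivative ?X (at y) v)" for v
      using continuous_on_subset[OF smooth_on_imp_continuous_deriv[OF X] r(2)] .
  qed (use that in blast)
  have lip': "dist (- ?X y) (- ?X z) \<le> L * dist y z"
    if "y \<in> cball (crd c x) r" "z \<in> cball (crd c x) r" for y z
    using L(2)[OF that] by (simp add: dist_minus)
  obtain h f where f: "0 < h" "f 0 = crd c x" "f ` {0..h} \<subseteq> cball (crd c x) r"
    "\<And>t. t \<in> {0..h} \<Longrightarrow> (f has_vector_derivative - ?X (f t)) (at t within {0..h})"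
    using picard_lindelof_local[of "crd c x" r "\<lambda>y. - ?X y" L, OF lip' r(1) L(1)] by blast
  define g where "g t = f (- t)" for t
  have gS: "g t \<in> ?S" if "t \<in> {-h..0}" for t
    using f(3) r(2) that unfolding g_def by (auto simp: image_subset_iff subset_iff)
  have g: "(g has_vector_derivative ?X (g t)) (at t within {-h..0})" if t: "t \<in> {-h..0}" for t
  proof -
    have im: "uminus ` {-h..0} = {0..h}" by simp
    have "(f \<circ> uminus has_vector_derivative (-1) *\<^sub>R - ?X (f (- t))) (at t within {-h..0})"
      by (rule vector_diff_chain_within)
        (use f(4)[of "- t"] t im in \<open>auto intro!: derivative_eq_intros\<close>)
    then show ?thesis by (simp add: g_def[abs_def] comp_def)
  qed
  have g_cont: "continuous_on {-h..0} g"
    by (rule continuous_on_vector_derivative[where f' = "\<lambda>t. ?X (g t)"]) (rule g)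
  have "integral_curve M u (cinv c \<circ> g) {-h..0}"
    unfolding integral_curve_def
  proof (intro conjI ballI impI)
    show "is_interval {-h..0}" by (simp add: is_interval_cc)
    show "interior {-h..0} \<noteq> {}" using f(1) by simp
    show "continuous_map (top_of_set {-h..0}) (st_top M) (cinv c \<circ> g)"
      by (rule continuous_map_compose[OF _ chart_continuous_cinv[OF ch]])
        (use g_cont gS in \<open>auto simp: continuous_map_in_subtopology image_subset_iff\<close>)
    fix t c' assume t: "t \<in> {-h..0}" and c': "c' \<in> st_atlas M" "(cinv c \<circ> g) t \<in> cdom c'"
    let ?y = "cinv c (g t)"
    have y: "?y \<in> cdom c \<inter> cdom c'" "crd c ?y = g t"
      using c' cinv_in_dom[OF gS[OF t]] crd_cinv[OF gS[OF t]] by auto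
    have d: "(crd c' \<circ> cinv c has_derivative (\<lambda>v. jac c id c' ?y *v v)) (at (g t))"
      using jac_has_derivative[OF M c(1) c'(1) y(1)] y(2) by simp
    have "(crd c' \<circ> cinv c \<circ> g has_vector_derivative jac c id c' ?y *v ?X (g t)) (at t within {-h..0})"
      by (rule vector_derivative_diff_chain_within[OF g[OF t] has_derivative_at_withinI[OF d]])
    moreover have "u c' ?y = jac c id c' ?y *v u c ?y"
      using u(1) c(1) c'(1) y(1) unfolding vector_field_def by blast
    then have "jac c id c' ?y *v ?X (g t) = u c' ((cinv c \<circ> g) t)" by (simp only: comp_apply)
    ultimately show "(crd c' \<circ> (cinv c \<circ> g) has_vector_derivative u c' ((cinv c \<circ> g) t)) (at t within {-h..0})"
      by (simp only: comp_assoc)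
  qed
  moreover have "(cinv c \<circ> g) 0 = x" using f(2) cinv_crd[OF ch c(2)] by (simp add: g_def)
  ultimately show ?thesis using that f(1) by blast
qed

lemma past_maximal_integral_curve_exists:
  assumes M: "smooth_manifold (st_top M) (st_atlas M)"
    and u: "vector_field (st_atlas M) u" "smooth_comps (st_atlas M) u" and x: "x \<in> pts M"
  obtains \<gamma> J where "past_maximal_integral_curve M u \<gamma> J" "J \<subseteq> {..0}" "0 \<in> J" "\<gamma> 0 = x"
proof -
  \<comment> \<open>Zorn's lemma on graphs of curves with right end 0; uniqueness of integral curves is not used.\<close>
  define gr where "gr \<gamma> J = (\<lambda>t. (t, \<gamma> t)) ` J" for \<gamma> :: "real \<Rightarrow> 'a" and J
  define ok where "ok \<gamma> J \<longleftrightarrow> integral_curve M u \<gamma> J \<and> J \<subseteq> {..0} \<and> 0 \<in> J \<and> \<gamma> 0 = x" for \<gamma> J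
  define \<A> where "\<A> = {gr \<gamma> J | \<gamma> J. ok \<gamma> J}"
  have gr_subset: "J \<subseteq> K \<and> (\<forall>t\<in>J. \<gamma> t = \<delta> t)" if "gr \<gamma> J \<subseteq> gr \<delta> K" for \<gamma> \<delta> J K
    using that by (auto simp: gr_def)
  obtain h \<gamma>0 where "0 < h" "integral_curve M u \<gamma>0 {-h..0}" "\<gamma>0 0 = x"
    using past_integral_curve_exists[OF assms] .
  then have "gr \<gamma>0 {-h..0} \<in> \<A>" unfolding \<A>_def ok_def by force
  then have ne: "\<A> \<noteq> {}" by blast
  have union: "\<Union>\<C> \<in> \<A>" if Cne: "\<C> \<noteq> {}" and ch: "subset.chain \<A> \<C>" for \<C>
  proof -
    have CA: "\<C> \<subseteq> \<A>" and lin: "\<And>G H. G \<in> \<C> \<Longrightarrow> H \<in> \<C> \<Longrightarrow> G \<subseteq> H \<or> H \<subseteq> G"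
      using ch by (auto simp: subset_chain_def)
    define J where "J = fst ` \<Union>\<C>"
    define \<gamma> where "\<gamma> t = (SOME y. (t, y) \<in> \<Union>\<C>)" for t
    \<comment> \<open>Graphs in a chain are nested, so all members defined at t have the same value
      there, and the choice in the definition of \<open>\<gamma>\<close> is forced.\<close>
    have val: "\<gamma> t = f t \<and> t \<in> J" if G: "gr f K \<in> \<C>" and t: "t \<in> K" for f K t
    proof -
      have mem: "(t, f t) \<in> \<Union>\<C>" using G t by (auto simp: gr_def)
      have "y = f t" if y: "(t, y) \<in> \<Union>\<C>" for y
      proof -
        obtain H where H: "H \<in> \<C>" "(t, y) \<in> H" using y by auto
        obtain f' K' where fK: "H = gr f' K'" using H CA unfolding \<A>_def by blast
        have y': "y = f' t" "t \<in> K'" using H(2) unfolding fK gr_def by auto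
        have "gr f' K' \<subseteq> gr f K \<or> gr f K \<subseteq> gr f' K'" using lin[OF H(1) G] unfolding fK .
        then show ?thesis
        proof
          assume "gr f' K' \<subseteq> gr f K"
          then show ?thesis using gr_subset y' by metis
        next
          assume "gr f K \<subseteq> gr f' K'"
          then show ?thesis using gr_subset y'(1) t by metis
        qed
      qed
      then have "\<gamma> t = f t" unfolding \<gamma>_def using mem by (metis (mono_tags, lifting) someI)
      moreover have "t \<in> J" using mem unfolding J_def by force
      ultimately show ?thesis by simp
    qed
    have J: "\<exists>f K. gr f K \<in> \<C> \<and> ok f K \<and> t \<in> K" if tJ: "t \<in> J" for t
    proof -
      obtain G y where "G \<in> \<C>" "(t, y) \<in> G" using tJ by (auto simp: J_def)
      moreover obtain f K where "G = gr f K" "ok f K" using \<open>G \<in> \<C>\<close> CA unfolding \<A>_def by blast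
      ultimately show ?thesis by (auto simp: gr_def)
    qed
    \<comment> \<open>Each domain is an interval containing its right end 0, so it contains
      everything between any of its points and 0.\<close>
    have down: "s \<in> K" if fK: "gr f K \<in> \<C>" "ok f K" "t \<in> K" "t \<le> s" "s \<le> 0" for f K s t
      using fK unfolding ok_def integral_curve_def is_interval_1 by blast
    have U: "\<Union>\<C> = gr \<gamma> J"
    proof -
      have "(t, y) \<in> gr \<gamma> J" if y: "(t, y) \<in> G" "G \<in> \<C>" for t y G
      proof -
        obtain f K where "G = gr f K" using y CA unfolding \<A>_def by blast
        then show ?thesis using val[of f K t] y by (auto simp: gr_def)
      qed
      moreover have "(t, \<gamma> t) \<in> \<Union>\<C>" if t: "t \<in> J" for t
      proof -
        obtain f K where f: "gr f K \<in> \<C>" "ok f K" "t \<in> K" using J[OF t] by blast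
        then have "(t, \<gamma> t) \<in> gr f K" using val[OF f(1,3)] by (simp add: gr_def)
        then show ?thesis using f(1) by blast
      qed
      ultimately show ?thesis unfolding gr_def by auto
    qed
    obtain G where G: "G \<in> \<C>" using Cne by blast
    then obtain f0 K0 where f0: "gr f0 K0 \<in> \<C>" "ok f0 K0" using CA unfolding \<A>_def by blast
    have sub: "J \<subseteq> {..0}" using J unfolding ok_def by blast
    have zero: "0 \<in> J" "\<gamma> 0 = x" using val[OF f0(1), of 0] f0(2) unfolding ok_def by auto
    have "integral_curve M u \<gamma> J"
    proof (rule integral_curve_localI)
      show "is_interval J"
        unfolding is_interval_1
      proof (intro ballI allI impI)
        fix a b s assume ab: "a \<in> J" "b \<in> J" and "a \<le> s \<and> s \<le> b"
        moreover obtain f K where f: "gr f K \<in> \<C>" "ok f K" "a \<in> K" using J[OF ab(1)] by blast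
        moreover have "b \<le> 0" using sub ab(2) by auto
        ultimately have "s \<in> K" using down[OF f, of s] by linarith
        then show "s \<in> J" using val[OF f(1)] by blast
      qed
      have "K0 \<subseteq> J" using val[OF f0(1)] by blast
      then show "interior J \<noteq> {}"
        using f0(2) interior_mono unfolding ok_def integral_curve_def by blast
      fix t assume t: "t \<in> J"
      show "\<exists>K W f. open W \<and> t \<in> W \<and> J \<inter> W \<subseteq> K \<and> K \<subseteq> J \<and> integral_curve M u f K \<and> (\<forall>s\<in>K. \<gamma> s = f s)"
      \<comment> \<open>If some s in \<open>J\<close> precedes t, a member defined at s covers all
        of \<open>J\<close> beyond s, a neighbourhood of t. If t is the least point of
        \<open>J\<close>, a member defined at t already covers \<open>J\<close>, and the
        neighbourhood can be the whole line.\<close>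
      proof (cases "\<exists>s\<in>J. s < t")
        case True
        then obtain s where s: "s \<in> J" "s < t" by blast
        obtain f K where f: "gr f K \<in> \<C>" "ok f K" "s \<in> K" using J[OF s(1)] by blast
        have "J \<inter> {s<..} \<subseteq> K" using down[OF f] sub by auto
        then show ?thesis
          using s f val[OF f(1)] unfolding ok_def
          by (intro exI[of _ K] exI[of _ "{s<..}"] exI[of _ f]) auto
      next
        case False
        obtain f K where f: "gr f K \<in> \<C>" "ok f K" "t \<in> K" using J[OF t] by blast
        have "J \<subseteq> K" using down[OF f] sub False by force
        then show ?thesis
          using f val[OF f(1)] unfolding ok_def
          by (intro exI[of _ K] exI[of _ UNIV] exI[of _ f]) auto
      qed
    qed
    then have "ok \<gamma> J" using sub zero unfolding ok_def by blast
    then show ?thesis unfolding U \<A>_def by blast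
  qed
  obtain G where G: "G \<in> \<A>" "\<And>H. H \<in> \<A> \<Longrightarrow> G \<subseteq> H \<Longrightarrow> H = G"
    using subset_Zorn_nonempty[OF ne union] by metis
  obtain \<gamma> J where GJ: "G = gr \<gamma> J" "ok \<gamma> J" using G(1) unfolding \<A>_def by blast
  have "past_maximal_integral_curve M u \<gamma> J"
    unfolding past_maximal_integral_curve_def
  proof (intro conjI allI impI ballI)
    show "integral_curve M u \<gamma> J" using GJ(2) unfolding ok_def by blast
    fix \<gamma>' J' s
    assume "integral_curve M u \<gamma>' J' \<and> J \<subseteq> J' \<and> (\<forall>t\<in>J. \<gamma>' t = \<gamma> t)" and s: "s \<in> J'"
    then have *: "integral_curve M u \<gamma>' J'" "J \<subseteq> J'" "\<And>t. t \<in> J \<Longrightarrow> \<gamma>' t = \<gamma> t" by auto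
    show "\<exists>t\<in>J. t \<le> s"
    proof (rule ccontr)
      assume no: "\<not> (\<exists>t\<in>J. t \<le> s)"
      have J0: "J \<subseteq> {..0}" "0 \<in> J" "\<gamma> 0 = x" "interior J \<noteq> {}" using GJ(2) unfolding ok_def integral_curve_def by auto
      then have s0: "s < 0" using no by force
      \<comment> \<open>The competing curve may run past 0; cutting it there makes it comparable
        with members of \<open>\<A>\<close>. As s is negative, it survives the cut and contradicts
        the maximality of the graph.\<close>
      let ?K = "J' \<inter> {..0}"
      have JK: "J \<subseteq> ?K" using * J0 by auto
      have "integral_curve M u \<gamma>' ?K"
      proof (rule integral_curve_subset[OF *(1)])
        show "is_interval ?K"
          using *(1) unfolding integral_curve_def by (intro is_interval_Int) auto
        show "interior ?K \<noteq> {}" using interior_mono[OF JK] J0 by blast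
      qed auto
      then have "ok \<gamma>' ?K" unfolding ok_def using J0 * by auto
      then have "gr \<gamma>' ?K \<in> \<A>" unfolding \<A>_def by blast
      moreover have "gr \<gamma> J \<subseteq> gr \<gamma>' ?K" using JK * by (force simp: gr_def)
      ultimately have "gr \<gamma>' ?K = gr \<gamma> J" using G(2) GJ(1) by blast
      then have "s \<in> J" using s s0 gr_subset[of \<gamma>' ?K \<gamma> J] by auto
      then show False using no by blast
    qed
  qed
  then show ?thesis using that GJ(2) unfolding ok_def by blast
qed

section \<open>Coordinate segments are timelike curves\<close>

lemma inner_matrix_transform:
  fixes H J :: "real ^ 'd::finite ^ 'd"
  shows "v \<bullet> ((transpose J ** H ** J) *v w) = (J *v v) \<bullet> (H *v (J *v w))"
proof -
  have "(transpose J ** H ** J) *v w = transpose J *v (H *v (J *v w))"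
    by (simp only: matrix_vector_mul_assoc matrix_mul_assoc)
  then show ?thesis
    by (metis dot_lmul_matrix vector_transpose_matrix)
qed

lemma cov2_tensor_inner:
  assumes "cov2_tensor A h" "c \<in> A" "c' \<in> A" "x \<in> cdom c \<inter> cdom c'"
  shows "(jac c id c' x *v v) \<bullet> (h c' x *v (jac c id c' x *v w)) = v \<bullet> (h c x *v w)"
proof -
  have "h c x = transpose (jac c id c' x) ** h c' x ** jac c id c' x"
    using assms unfolding cov2_tensor_def by blast
  then show ?thesis by (simp only: inner_matrix_transform)
qed

lemma eventually_segment_in_open:
  fixes z v :: "'a::real_normed_vector"
  assumes "open S" "z + t *\<^sub>R v \<in> S"
  obtains e where "e > 0" "\<And>r. \<bar>r - t\<bar> < e \<Longrightarrow> z + r *\<^sub>R v \<in> S"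
proof -
  have "open ((\<lambda>r. z + r *\<^sub>R v) -` S)"
    by (intro continuous_open_vimage assms(1) continuous_intros)
  then obtain e where "e > 0" "ball t e \<subseteq> (\<lambda>r. z + r *\<^sub>R v) -` S"
    using assms(2) open_contains_ball by (metis vimageI)
  then show ?thesis using that[of e] by (auto simp: dist_real_def subset_iff abs_minus_commute)
qed

lemma chart_line_derivative:
  assumes A: "smooth_manifold T A" "c \<in> A" "c' \<in> A"
    and y: "z + t *\<^sub>R v \<in> crd c ` cdom c" and c': "cinv c (z + t *\<^sub>R v) \<in> cdom c'"
  shows "((crd c' \<circ> (\<lambda>r. cinv c (z + r *\<^sub>R v))) has_vector_derivative
    jac c id c' (cinv c (z + t *\<^sub>R v)) *v v) (at t)"
proof -
  let ?x = "cinv c (z + t *\<^sub>R v)"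
  have x: "?x \<in> cdom c \<inter> cdom c'" "crd c ?x = z + t *\<^sub>R v"
    using cinv_in_dom[OF y] crd_cinv[OF y] c' by auto
  have "(crd c' \<circ> cinv c has_derivative (\<lambda>w. jac c id c' ?x *v w)) (at (z + t *\<^sub>R v))"
    using jac_has_derivative[OF A x(1)] x(2) by simp
  moreover have "((\<lambda>r. z + r *\<^sub>R v) has_vector_derivative v) (at t)"
    by (auto intro!: derivative_eq_intros simp: has_vector_derivative_def)
  ultimately have "(crd c' \<circ> cinv c \<circ> (\<lambda>r. z + r *\<^sub>R v) has_vector_derivative
      jac c id c' ?x *v v) (at t)"
    using vector_derivative_diff_chain_within[of "\<lambda>r. z + r *\<^sub>R v" v t UNIV "crd c' \<circ> cinv c"
        "\<lambda>w. jac c id c' ?x *v w"] has_derivative_at_withinI by blast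
  then show ?thesis by (simp add: comp_def)
qed

lemma chart_line_continuous:
  assumes c: "is_chart T c" and K: "\<And>t. t \<in> K \<Longrightarrow> z + t *\<^sub>R v \<in> crd c ` cdom c"
  shows "continuous_map (top_of_set K) T (\<lambda>r. cinv c (z + r *\<^sub>R v))"
proof -
  have "continuous_map (top_of_set K) (top_of_set (crd c ` cdom c)) (\<lambda>r. z + r *\<^sub>R v)"
    unfolding continuous_map_in_subtopology
    using K by (auto intro!: continuous_intros)
  from continuous_map_compose[OF this chart_continuous_cinv[OF c]]
  show ?thesis by (simp add: comp_def)
qed

text \<open>Seen in another chart, the velocity of the segment is the derivative of the transition
  map in the fixed direction v, which is continuous by smoothness. The exceptional set is therefore
  empty.\<close>

lemma piecewise_C1_chart_line:
  assumes A: "smooth_manifold T A" "c \<in> A"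
    and line: "\<And>t. t \<in> {0..1} \<Longrightarrow> z + t *\<^sub>R v \<in> crd c ` cdom c"
  shows "piecewise_C1_curve T A (\<lambda>t. cinv c (z + t *\<^sub>R v))"
  unfolding piecewise_C1_curve_def
proof (intro conjI exI[of _ "{}"] ballI impI)
  show "continuous_map (top_of_set {0..1}) T (\<lambda>t. cinv c (z + t *\<^sub>R v))"
    using chart_line_continuous[OF manifold_chart[OF A] line] .
  fix t :: real and c'
  assume t: "t \<in> {0<..<1} - {}" and c': "c' \<in> A" "cinv c (z + t *\<^sub>R v) \<in> cdom c'"
  let ?W = "crd c ` (cdom c \<inter> cdom c')"
  have y: "z + t *\<^sub>R v \<in> crd c ` cdom c" using line[of t] t by auto
  have "z + t *\<^sub>R v \<in> ?W"
    using c'(2) cinv_in_dom[OF y] crd_cinv[OF y] by (metis IntI imageI)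
  then obtain e where e: "e > 0" "\<And>r. \<bar>r - t\<bar> < e \<Longrightarrow> z + r *\<^sub>R v \<in> ?W"
    using eventually_segment_in_open[OF chart_overlap_open[OF A c'(1)]] by blast
  let ?I = "{t - e<..<t + e}" and ?D = "\<lambda>r. frechet_derivative (crd c' \<circ> cinv c) (at (z + r *\<^sub>R v)) v"
  have W: "z + r *\<^sub>R v \<in> ?W" if "r \<in> ?I" for r using that e(2)[of r] by auto
  have sm: "smooth_on ?W (crd c' \<circ> cinv c)"
    using manifold_compatible[OF A c'(1)] unfolding smoothly_compatible_def by blast
  have "(crd c' \<circ> (\<lambda>t. cinv c (z + t *\<^sub>R v))) C1_differentiable_on ?I"
    unfolding C1_differentiable_on_def
  proof (intro exI[of _ ?D] conjI ballI)
    have line_cont: "continuous_on ?I (\<lambda>r. z + r *\<^sub>R v)" by (intro continuous_intros)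
    show "continuous_on ?I ?D"
      by (rule continuous_on_compose2[OF smooth_on_imp_continuous_deriv[OF sm] line_cont])
        (use W in auto)
    fix r assume r: "r \<in> ?I"
    obtain x where x: "x \<in> cdom c \<inter> cdom c'" "z + r *\<^sub>R v = crd c x" using W[OF r] by blast
    have xr: "cinv c (z + r *\<^sub>R v) = x" using x cinv_crd[OF manifold_chart[OF A]] by simp
    have "((crd c' \<circ> (\<lambda>r. cinv c (z + r *\<^sub>R v))) has_vector_derivative jac c id c' x *v v) (at r)"
      using chart_line_derivative[OF A c'(1), of z r v] x xr by auto
    moreover have "?D r = jac c id c' x *v v"
      using frechet_derivative_at[OF jac_has_derivative[OF A c'(1) x(1)]] x(2) by metis
    ultimately show "((crd c' \<circ> (\<lambda>r. cinv c (z + r *\<^sub>R v))) has_vector_derivative ?D r) (at r)"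
      by simp
  qed
  then show "\<exists>e>0. (crd c' \<circ> (\<lambda>t. cinv c (z + t *\<^sub>R v))) C1_differentiable_on {t - e<..<t + e}"
    using e(1) by blast
qed simp

text \<open>\<open>speed\<close> evaluates the norm in an arbitrarily chosen chart; the
  transformation law of \<open>h\<close> brings the value back to the chart
  \<open>c\<close>.\<close>

lemma speed_chart_line:
  assumes A: "smooth_manifold T A" "c \<in> A" and h: "cov2_tensor A h"
    and y: "z + t *\<^sub>R v \<in> crd c ` cdom c"
  shows "speed A h (\<lambda>t. cinv c (z + t *\<^sub>R v)) t = sqrt (v \<bullet> (h c (cinv c (z + t *\<^sub>R v)) *v v))"
proof -
  let ?x = "cinv c (z + t *\<^sub>R v)"
  define c' where "c' = (SOME c'. c' \<in> A \<and> ?x \<in> cdom c')"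
  have "\<exists>c'. c' \<in> A \<and> ?x \<in> cdom c'" using A(2) cinv_in_dom[OF y] by blast
  then have "c' \<in> A \<and> ?x \<in> cdom c'" unfolding c'_def by (rule someI_ex)
  then have c': "c' \<in> A" "?x \<in> cdom c'" by auto
  have "vector_derivative (crd c' \<circ> (\<lambda>t. cinv c (z + t *\<^sub>R v))) (at t) = jac c id c' ?x *v v"
    using vector_derivative_at[OF chart_line_derivative[OF A c'(1) y c'(2)]] .
  then have "speed A h (\<lambda>t. cinv c (z + t *\<^sub>R v)) t =
      sqrt ((jac c id c' ?x *v v) \<bullet> (h c' ?x *v (jac c id c' ?x *v v)))"
    unfolding speed_def Let_def c'_def[symmetric] by simp
  also have "\<dots> = sqrt (v \<bullet> (h c ?x *v v))"
    using cov2_tensor_inner[OF h A(2) c'(1), of ?x v v] cinv_in_dom[OF y] c'(2) by simp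
  finally show ?thesis .
qed

text \<open>The distance is an infimum of lengths, and the segment over \<open>{0..1}\<close> is an
  admissible competitor of length at most \<open>K\<close>.\<close>

lemma riem_dist_chart_line_le:
  assumes A: "smooth_manifold T A" "c \<in> A" and h: "cov2_tensor A h"
    and line: "\<And>t. t \<in> {0..1} \<Longrightarrow> z + t *\<^sub>R v \<in> crd c ` cdom c"
    and K: "\<And>t. t \<in> {0..1} \<Longrightarrow> sqrt (v \<bullet> (h c (cinv c (z + t *\<^sub>R v)) *v v)) \<le> K" and "0 \<le> K"
  shows "riem_dist T A h (cinv c z) (cinv c (z + v)) \<le> K"
proof -
  let ?\<gamma> = "\<lambda>t. cinv c (z + t *\<^sub>R v)"
  have "curve_length A h ?\<gamma> \<le> (\<integral>\<^sup>+ t \<in> {0..1::real}. ennreal K \<partial>lborel)"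
    unfolding curve_length_def
  proof (rule nn_integral_mono)
    fix t :: real
    show "ennreal (speed A h ?\<gamma> t) * indicator {0..1} t \<le> ennreal K * indicator {0..1} t"
      using speed_chart_line[OF A h line] K by (auto simp: indicator_def intro!: ennreal_leI)
  qed
  also have "\<dots> = ennreal K"
    by (simp add: nn_integral_cmult_indicator)
  finally have "curve_length A h ?\<gamma> \<le> ennreal K" .
  moreover have "?\<gamma> \<in> {\<gamma>. piecewise_C1_curve T A \<gamma> \<and> \<gamma> 0 = cinv c z \<and> \<gamma> 1 = cinv c (z + v)}"
    using piecewise_C1_chart_line[OF A line] by simp
  ultimately show ?thesis
    unfolding riem_dist_def using \<open>0 \<le> K\<close> by (intro enn2real_leI INF_lower2)
qed

text \<open>By compactness the speed is bounded along the segment. The piece from s to t,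
  reparametrised over \<open>{0..1}\<close>, has velocity (t - s) w, which produces the factor |s -
  t| in the distance estimate.\<close>

lemma lipschitz_chart_line:
  assumes N: "smooth_manifold (st_top N) (st_atlas N)" and c: "c \<in> st_atlas N"
    and h: "complete_riemannian_metric (st_top N) (st_atlas N) h"
    and line: "\<And>t. t \<in> {0..b} \<Longrightarrow> y + t *\<^sub>R w \<in> crd c ` cdom c"
  shows "lipschitz_curve N (\<lambda>t. cinv c (y + t *\<^sub>R w)) 0 b"
proof -
  let ?S = "crd c ` cdom c" and ?f = "\<lambda>t. sqrt (w \<bullet> (h c (cinv c (y + t *\<^sub>R w)) *v w))"
  have ch: "is_chart (st_top N) c" using manifold_chart[OF N c] .
  have hA: "cov2_tensor (st_atlas N) h" and hs: "smooth_on ?S (h c \<circ> cinv c)"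
    using h c unfolding complete_riemannian_metric_def riemannian_metric_def smooth_comps_def by auto
  have line_cont: "continuous_on {0..b} (\<lambda>t. y + t *\<^sub>R w)" by (intro continuous_intros)
  have "continuous_on {0..b} (\<lambda>t. (h c \<circ> cinv c) (y + t *\<^sub>R w))"
    by (rule continuous_on_compose2[OF smooth_on_imp_continuous_on[OF hs] line_cont]) (use line in auto)
  then have "continuous_on {0..b} ?f"
    by (auto intro!: continuous_intros simp: matrix_vector_mult_def)
  then have "bounded (?f ` {0..b})"
    using compact_imp_bounded[OF compact_continuous_image] compact_Icc by blast
  then obtain L where L: "\<And>t. t \<in> {0..b} \<Longrightarrow> \<bar>?f t\<bar> \<le> L" unfolding bounded_iff by fastforce
  have "riem_dist (st_top N) (st_atlas N) h (cinv c (y + s *\<^sub>R w)) (cinv c (y + t *\<^sub>R w)) \<le> \<bar>L\<bar> * \<bar>s - t\<bar>"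
    if st: "s \<in> {0..b}" "t \<in> {0..b}" for s t
  proof -
    let ?v = "(t - s) *\<^sub>R w" and ?z = "y + s *\<^sub>R w"
    have eq: "?z + r *\<^sub>R ?v = y + (s + r * (t - s)) *\<^sub>R w" for r
      by (simp add: algebra_simps)
    have mem: "s + r * (t - s) \<in> {0..b}" if r: "r \<in> {0..1}" for r
    proof -
      have "s + r * (t - s) = (1 - r) * s + r * t" by (simp add: algebra_simps)
      moreover have "(1 - r) * s + r * t \<le> b"
        using st r convex_bound_le[of s b t "1 - r" r] by auto
      ultimately show ?thesis using st r by auto
    qed
    have "riem_dist (st_top N) (st_atlas N) h (cinv c ?z) (cinv c (?z + ?v)) \<le> \<bar>L\<bar> * \<bar>s - t\<bar>"
    proof (rule riem_dist_chart_line_le[OF N c hA])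
      fix r :: real assume r: "r \<in> {0..1}"
      show "?z + r *\<^sub>R ?v \<in> ?S" unfolding eq using line[OF mem[OF r]] .
      have "?v \<bullet> (H *v ?v) = (t - s)\<^sup>2 * (w \<bullet> (H *v w))" for H :: "real ^ 'b ^ 'b"
        by (simp add: matrix_vector_mult_scaleR power2_eq_square)
      then have "sqrt (?v \<bullet> (h c (cinv c (?z + r *\<^sub>R ?v)) *v ?v)) = \<bar>t - s\<bar> * ?f (s + r * (t - s))"
        unfolding eq by (simp only: real_sqrt_mult real_sqrt_abs)
      also have "\<dots> \<le> \<bar>t - s\<bar> * \<bar>L\<bar>"
        using L[OF mem[OF r]] by (intro mult_left_mono) auto
      finally show "sqrt (?v \<bullet> (h c (cinv c (?z + r *\<^sub>R ?v)) *v ?v)) \<le> \<bar>L\<bar> * \<bar>s - t\<bar>"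
        by (simp add: abs_minus_commute mult.commute)
    qed simp
    moreover have "?z + ?v = y + t *\<^sub>R w" by (simp add: algebra_simps)
    ultimately show ?thesis by simp
  qed
  moreover have "(\<lambda>t. cinv c (y + t *\<^sub>R w)) ` {0..b} \<subseteq> pts N"
    using cinv_in_dom[OF line] chart_dom_subset[OF ch] by blast
  ultimately show ?thesis unfolding lipschitz_curve_def using h by blast
qed

text \<open>Metric and time orientation are continuous, so a constant coordinate vector that is
  future timelike at q remains so along a short segment from q. A complete metric \<open>h\<close>
  enters because \<open>timelike_curve\<close> demands the Lipschitz property for one.\<close>

lemma timelike_chart_line:
  assumes N: "continuous_spacetime N" and c: "c \<in> st_atlas N" and q: "q \<in> cdom c"
    and h: "complete_riemannian_metric (st_top N) (st_atlas N) h"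
    and w: "future_timelike N c q w"
  obtains b0 where "0 < b0" "\<And>b. 0 < b \<Longrightarrow> b \<le> b0 \<Longrightarrow> crd c q + b *\<^sub>R w \<in> crd c ` cdom c \<and>
    cinv c (crd c q + b *\<^sub>R w) \<in> timelike_future q N"
proof -
  let ?S = "crd c ` cdom c" and ?A = "st_atlas N" and ?y = "crd c q"
  have man: "smooth_manifold (st_top N) ?A" and g: "cov2_tensor ?A (st_metric N)"
    and gc: "continuous_on ?S (st_metric N c \<circ> cinv c)"
    and o: "vector_field ?A (st_orient N)" and oc: "continuous_on ?S (st_orient N c \<circ> cinv c)"
    using N c unfolding continuous_spacetime_def continuous_comps_def by auto
  have ch: "is_chart (st_top N) c" using manifold_chart[OF man c] .
  have yS: "?y \<in> ?S" using q by auto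
  have inv: "cinv c ?y = q" using cinv_crd[OF ch q] .
  let ?G = "\<lambda>y. ginner N c (cinv c y) w w"
  let ?T = "\<lambda>y. ginner N c (cinv c y) (st_orient N c (cinv c y)) w"
  have gc': "continuous_on ?S (\<lambda>y. st_metric N c (cinv c y))" and oc': "continuous_on ?S (\<lambda>y. st_orient N c (cinv c y))"
    using gc oc by (simp_all add: comp_def)
  have G: "continuous_on ?S ?G" and T: "continuous_on ?S ?T"
    unfolding ginner_def matrix_vector_mult_def by (auto intro!: continuous_intros gc' oc')
  \<comment> \<open>Half the size of g(w,w) at q leaves room for the variation of the metric and
    still gives the uniform bound that \<open>timelike_curve\<close> requires.\<close>
  define \<epsilon> where "\<epsilon> = - ?G ?y / 2"
  have eps: "0 < \<epsilon>" "?G ?y < - \<epsilon>" "?T ?y < 0" using w inv unfolding future_timelike_def \<epsilon>_def by auto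
  let ?W = "?S \<inter> ?G -` {..< - \<epsilon>} \<inter> (?S \<inter> ?T -` {..<0})"
  have "open ?W"
    by (intro open_Int continuous_open_preimage G T chart_open_range[OF ch]) auto
  moreover have "?y + 0 *\<^sub>R w \<in> ?W" using eps yS by simp
  ultimately obtain e where e: "e > 0" "\<And>r. \<bar>r - 0\<bar> < e \<Longrightarrow> ?y + r *\<^sub>R w \<in> ?W"
    using eventually_segment_in_open by blast
  let ?\<gamma> = "\<lambda>t. cinv c (?y + t *\<^sub>R w)"
  have "?y + b *\<^sub>R w \<in> ?S \<and> ?\<gamma> b \<in> timelike_future q N" if b: "0 < b" "b \<le> e / 2" for b
  proof -
    have line: "?y + t *\<^sub>R w \<in> ?W" if "t \<in> {0..b}" for t using e(2)[of t] that b e(1) by auto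
    have der: "\<exists>v. ((crd c' \<circ> ?\<gamma>) has_vector_derivative v) (at t) \<and>
        future_timelike N c' (?\<gamma> t) v \<and> ginner N c' (?\<gamma> t) v v < - \<epsilon>"
      if t: "t \<in> {0..b}" and c': "c' \<in> ?A" "?\<gamma> t \<in> cdom c'" for t c'
    proof (intro exI conjI)
      let ?x = "?\<gamma> t"
      have W: "?y + t *\<^sub>R w \<in> ?S" "?G (?y + t *\<^sub>R w) < - \<epsilon>" "?T (?y + t *\<^sub>R w) < 0"
        using line[OF t] by auto
      have x: "?x \<in> cdom c \<inter> cdom c'" using cinv_in_dom[OF W(1)] c'(2) by blast
      let ?v = "jac c id c' ?x *v w"
      show "((crd c' \<circ> ?\<gamma>) has_vector_derivative ?v) (at t)"
        using chart_line_derivative[OF man c c'(1) W(1) c'(2)] .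
      have vv: "ginner N c' ?x ?v ?v = ?G (?y + t *\<^sub>R w)"
        unfolding ginner_def using cov2_tensor_inner[OF g c c'(1) x] .
      then show "ginner N c' ?x ?v ?v < - \<epsilon>" using W(2) by simp
      have "st_orient N c' ?x = jac c id c' ?x *v st_orient N c ?x"
        using o c c'(1) x unfolding vector_field_def by blast
      then have "ginner N c' ?x (st_orient N c' ?x) ?v = ?T (?y + t *\<^sub>R w)"
        unfolding ginner_def using cov2_tensor_inner[OF g c c'(1) x, of "st_orient N c ?x" w] by metis
      then show "future_timelike N c' ?x ?v"
        unfolding future_timelike_def using vv W eps(1) by linarith
    qed
    have "AE t in lebesgue_on {0..b}. \<forall>c' \<in> ?A. ?\<gamma> t \<in> cdom c' \<longrightarrow>
        (\<exists>v. ((crd c' \<circ> ?\<gamma>) has_vector_derivative v) (at t) \<and>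
             future_timelike N c' (?\<gamma> t) v \<and> ginner N c' (?\<gamma> t) v v < - \<epsilon>)"
      by (rule AE_I2) (use der in auto)
    moreover have "lipschitz_curve N ?\<gamma> 0 b"
      using lipschitz_chart_line[OF man c h] line by blast
    ultimately have "timelike_curve N ?\<gamma> 0 b"
      unfolding timelike_curve_def using b(1) eps(1) by blast
    moreover have "?\<gamma> 0 = q" using inv by simp
    moreover have "?y + b *\<^sub>R w \<in> ?S" using line[of b] b by simp
    ultimately show ?thesis
      unfolding timelike_future_def by (intro conjI CollectI exI[of _ ?\<gamma>] exI[of _ 0] exI[of _ b]) auto
  qed
  then show ?thesis using that[of "e / 2"] e(1) by simp
qed

section \<open>The limit direction of the fluid\<close>

lemma invertible_matrix_inv:
  fixes A :: "'a::semiring_1 ^ 'n ^ 'm"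
  assumes "invertible A"
  shows matrix_inv_right: "A ** matrix_inv A = mat 1" and matrix_inv_left: "matrix_inv A ** A = mat 1"
proof -
  have "\<exists>B. A ** B = mat 1 \<and> B ** A = mat 1" using assms unfolding invertible_def .
  then have "A ** matrix_inv A = mat 1 \<and> matrix_inv A ** A = mat 1"
    unfolding matrix_inv_def by (rule someI_ex)
  then show "A ** matrix_inv A = mat 1" "matrix_inv A ** A = mat 1" by auto
qed

lemma matrix_inv_entry:
  fixes A :: "real ^ 'd::finite ^ 'd"
  assumes "det A \<noteq> 0"
  shows "matrix_inv A $ i $ j = det (\<chi> k l. if l = i then axis j 1 $ k else A $ k $ l) / det A"
proof -
  have "A *v (matrix_inv A *v axis j 1) = axis j 1"
    using assms by (simp add: matrix_vector_mul_assoc matrix_inv_right invertible_det_nz)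
  then have "matrix_inv A *v axis j 1 = (\<chi> i. det (\<chi> k l. if l = i then axis j 1 $ k else A $ k $ l) / det A)"
    using cramer[OF assms] by blast
  then show ?thesis by (metis (mono_tags, lifting) matrix_vector_mult_basis column_def vec_lambda_beta)
qed

lemma tendsto_det:
  fixes A :: "'p \<Rightarrow> real ^ 'd::finite ^ 'd"
  assumes "\<And>i j. ((\<lambda>x. A x $ i $ j) \<longlongrightarrow> A0 $ i $ j) F"
  shows "((\<lambda>x. det (A x)) \<longlongrightarrow> det A0) F"
  unfolding det_def by (intro tendsto_intros assms)

text \<open>Cramer's rule writes the entries of the inverse as quotients of determinants. It applies
  to \<open>A x\<close> eventually, since the determinants tend to that of \<open>A0\<close>, which
  is nonzero.\<close>

lemma tendsto_matrix_inv:
  fixes A :: "'p \<Rightarrow> real ^ 'd::finite ^ 'd"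
  assumes A: "\<And>i j. ((\<lambda>x. A x $ i $ j) \<longlongrightarrow> A0 $ i $ j) F" and "invertible A0"
  shows "((\<lambda>x. matrix_inv (A x) $ i $ j) \<longlongrightarrow> matrix_inv A0 $ i $ j) F"
proof -
  have d0: "det A0 \<noteq> 0" using assms(2) by (simp add: invertible_det_nz)
  have d: "((\<lambda>x. det (A x)) \<longlongrightarrow> det A0) F" using tendsto_det[OF A] .
  let ?B = "\<lambda>A. \<chi> k l. if l = i then axis j 1 $ k else A $ k $ l"
  have "((\<lambda>x. det (?B (A x))) \<longlongrightarrow> det (?B A0)) F"
    by (rule tendsto_det) (simp add: A)
  then have "((\<lambda>x. det (?B (A x)) / det (A x)) \<longlongrightarrow> matrix_inv A0 $ i $ j) F"
    unfolding matrix_inv_entry[OF d0] using d d0 by (intro tendsto_divide)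
  moreover have "\<forall>\<^sub>F x in F. det (?B (A x)) / det (A x) = matrix_inv (A x) $ i $ j"
    using tendsto_imp_eventually_ne[OF d d0] by eventually_elim (simp add: matrix_inv_entry)
  ultimately show ?thesis using tendsto_cong by fast
qed

lemma lorentzian_invertible:
  fixes G :: "real ^ 'd::finite ^ 'd"
  assumes "lorentzian_matrix G"
  shows "invertible G"
proof -
  obtain P :: "real ^ 'd ^ 'd" and i0 where "transpose P ** G ** P = (\<chi> i j. if i = j then (if i = i0 then - 1 else (1 :: real)) else 0)"
    (is "_ = ?D") using assms unfolding lorentzian_matrix_def by blast
  moreover have "det ?D = (\<Prod>i\<in>UNIV. ?D $ i $ i)" by (rule det_diagonal) simp
  then have "det ?D \<noteq> 0" by simp
  ultimately have "det (transpose P ** G ** P) \<noteq> 0" by simp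
  then show ?thesis by (simp add: det_mul invertible_det_nz)
qed

text \<open>The Einstein equations determine the products \<open>v\<^sub>i v\<^sub>j\<close> of the components of \<open>v\<close>, hence in the
  limit its direction but not its sign.\<close>

lemma direction_converges:
  fixes G R :: "'p \<Rightarrow> real ^ 'd::finite ^ 'd" and v :: "'p \<Rightarrow> real ^ 'd" and \<rho> p :: "'p \<Rightarrow> real"
  assumes einstein: "\<forall>\<^sub>F x in F. \<forall>i j.
      R x $ i $ j - 1/2 * (\<Sum>k\<in>UNIV. \<Sum>l\<in>UNIV. matrix_inv (G x) $ k $ l * R x $ k $ l) * G x $ i $ j =
      8 * pi * ((\<rho> x + p x) * ((G x *v v x) $ i * (G x *v v x) $ j) + p x * G x $ i $ j)"
    and unit: "\<forall>\<^sub>F x in F. v x \<bullet> (G x *v v x) = - 1"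
    and G: "\<And>i j. ((\<lambda>x. G x $ i $ j) \<longlongrightarrow> G0 $ i $ j) F" and "invertible G0"
    and Ginv: "\<forall>\<^sub>F x in F. invertible (G x)"
    and R: "\<And>i j. ((\<lambda>x. R x $ i $ j) \<longlongrightarrow> R0 i j) F"
    and \<rho>: "(\<rho> \<longlongrightarrow> a) F" and p: "(p \<longlongrightarrow> b) F" and ab: "a + b \<noteq> 0"
  obtains r k where "\<And>j \<epsilon>. 0 < \<epsilon> \<Longrightarrow> \<forall>\<^sub>F x in F. v x $ k \<noteq> 0 \<and> \<bar>v x $ j - r j * v x $ k\<bar> \<le> \<epsilon> * \<bar>v x $ k\<bar>"
proof (cases "F = bot")
  case True
  then show ?thesis using that[of undefined undefined] by simp
next
  case False
  let ?I = "\<lambda>x. matrix_inv (G x)" and ?w = "\<lambda>x. G x *v v x"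
  note I = tendsto_matrix_inv[OF G \<open>invertible G0\<close>]
  define S where "S x = (\<Sum>k\<in>UNIV. \<Sum>l\<in>UNIV. ?I x $ k $ l * R x $ k $ l)" for x
  define S0 where "S0 = (\<Sum>k\<in>UNIV. \<Sum>l\<in>UNIV. matrix_inv G0 $ k $ l * R0 k l)"
  have S: "(S \<longlongrightarrow> S0) F" unfolding S_def S0_def by (intro tendsto_intros I R)
  \<comment> \<open>The Einstein equations solved for the products of the covariant components of
    \<open>v\<close>. Dividing by \<open>\<rho> x + p x\<close> is harmless near the limit because
    \<open>a + b\<close> is nonzero.\<close>
  define T where "T i j x = ((R x $ i $ j - 1/2 * S x * G x $ i $ j) / (8 * pi) - p x * G x $ i $ j) / (\<rho> x + p x)" for i j x
  define T0 where "T0 i j = ((R0 i j - 1/2 * S0 * G0 $ i $ j) / (8 * pi) - b * G0 $ i $ j) / (a + b)" for i j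
  have T: "(T i j \<longlongrightarrow> T0 i j) F" for i j
    unfolding T_def T0_def by (intro tendsto_intros R S G \<rho> p ab) simp
  have ne: "\<forall>\<^sub>F x in F. \<rho> x + p x \<noteq> 0"
    using tendsto_imp_eventually_ne[OF tendsto_add[OF \<rho> p] ab] .
  have Tw: "\<forall>\<^sub>F x in F. \<forall>i j. T i j x = ?w x $ i * ?w x $ j"
    using einstein ne by eventually_elim (simp add: T_def S_def)
  \<comment> \<open>Both indices of \<open>T\<close> are raised with the inverse metric, which turns
    the covariant products into the products of the components of \<open>v\<close> itself.\<close>
  define U where "U i j x = (\<Sum>k\<in>UNIV. \<Sum>l\<in>UNIV. ?I x $ i $ k * ?I x $ j $ l * T k l x)" for i j x
  define U0 where "U0 i j = (\<Sum>k\<in>UNIV. \<Sum>l\<in>UNIV. matrix_inv G0 $ i $ k * matrix_inv G0 $ j $ l * T0 k l)" for i j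
  have U: "(U i j \<longlongrightarrow> U0 i j) F" for i j
    unfolding U_def U0_def by (intro tendsto_intros I T)
  have Uv: "\<forall>\<^sub>F x in F. \<forall>i j. U i j x = v x $ i * v x $ j"
    using Tw Ginv
  proof eventually_elim
    case (elim x)
    have "?I x *v ?w x = v x"
      using elim(2) by (simp add: matrix_vector_mul_assoc matrix_inv_left)
    then have vi: "v x $ i = (\<Sum>k\<in>UNIV. ?I x $ i $ k * ?w x $ k)" for i
      by (metis (no_types, lifting) matrix_vector_mult_def vec_lambda_beta sum.cong)
    have "v x $ i * v x $ j = U i j x" for i j
      unfolding vi[of i] vi[of j] U_def sum_product using elim(1)
      by (intro sum.cong refl) (simp add: mult_ac)
    then show ?case by simp
  qed
  have vv: "((\<lambda>x. v x $ i * v x $ j) \<longlongrightarrow> U0 i j) F" for i j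
  proof -
    have "\<forall>\<^sub>F x in F. U i j x = v x $ i * v x $ j" using Uv by eventually_elim simp
    then show ?thesis using U[of i j] tendsto_cong by fast
  qed
  \<comment> \<open>The normalisation g(v,v) = -1 passes to the limit: contracting \<open>U0\<close>
    with \<open>G0\<close> gives -1, so \<open>U0\<close> cannot vanish.\<close>
  have "((\<lambda>x. \<Sum>i\<in>UNIV. \<Sum>j\<in>UNIV. G x $ i $ j * (v x $ i * v x $ j)) \<longlongrightarrow>
      (\<Sum>i\<in>UNIV. \<Sum>j\<in>UNIV. G0 $ i $ j * U0 i j)) F"
    by (intro tendsto_intros G vv)
  moreover have "\<forall>\<^sub>F x in F. (\<Sum>i\<in>UNIV. \<Sum>j\<in>UNIV. G x $ i $ j * (v x $ i * v x $ j)) = - 1"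
    using unit by eventually_elim
      (simp add: inner_vec_def matrix_vector_mult_def sum_distrib_left mult_ac)
  ultimately have "((\<lambda>x. - 1) \<longlongrightarrow> (\<Sum>i\<in>UNIV. \<Sum>j\<in>UNIV. G0 $ i $ j * U0 i j)) F"
    using tendsto_cong by fast
  then have "(\<Sum>i\<in>UNIV. \<Sum>j\<in>UNIV. G0 $ i $ j * U0 i j) = - 1"
    using tendsto_unique[OF False _ tendsto_const] by blast
  then obtain k l where kl: "U0 k l \<noteq> 0"
    by (metis (no_types, lifting) mult_zero_right sum.neutral neg_equal_0_iff_equal zero_neq_one)
  \<comment> \<open>The rank-one relation between the products survives in the limit, so a nonzero
    entry \<open>U0 k l\<close> forces the diagonal entry \<open>U0 k k\<close> to be nonzero.
    Component k can then serve as denominator.\<close>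
  have "((\<lambda>x. (v x $ k * v x $ k) * (v x $ l * v x $ l)) \<longlongrightarrow> U0 k k * U0 l l) F"
    by (intro tendsto_mult vv)
  moreover have "(v x $ k * v x $ k) * (v x $ l * v x $ l) = (v x $ k * v x $ l) * (v x $ k * v x $ l)" for x
    by (simp add: mult_ac)
  ultimately have lim: "((\<lambda>x. (v x $ k * v x $ l) * (v x $ k * v x $ l)) \<longlongrightarrow> U0 k k * U0 l l) F" by simp
  have "U0 k k * U0 l l = U0 k l * U0 k l"
    by (rule tendsto_unique[OF False lim]) (intro tendsto_mult vv)
  then have kk: "U0 k k \<noteq> 0" using kl by auto
  show ?thesis
  proof
    fix j and \<epsilon> :: real assume "0 < \<epsilon>"
    have n: "\<forall>\<^sub>F x in F. v x $ k * v x $ k \<noteq> 0" using tendsto_imp_eventually_ne[OF vv kk] .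
    \<comment> \<open>The ratio v_j / v_k, expanded by v_k, involves only convergent products. Its
      limit is the slope taken as the witness for r_j.\<close>
    have "((\<lambda>x. (v x $ j * v x $ k) / (v x $ k * v x $ k)) \<longlongrightarrow> U0 j k / U0 k k) F"
      by (intro tendsto_divide vv kk)
    then have "\<forall>\<^sub>F x in F. dist ((v x $ j * v x $ k) / (v x $ k * v x $ k)) (U0 j k / U0 k k) < \<epsilon>"
      using \<open>0 < \<epsilon>\<close> by (rule tendstoD)
    with n show "\<forall>\<^sub>F x in F. v x $ k \<noteq> 0 \<and> \<bar>v x $ j - U0 j k / U0 k k * v x $ k\<bar> \<le> \<epsilon> * \<bar>v x $ k\<bar>"
    proof eventually_elim
      case (elim x)
      then have k: "v x $ k \<noteq> 0" by simp
      then have "\<bar>v x $ j / v x $ k - U0 j k / U0 k k\<bar> \<le> \<epsilon>" using elim by (simp add: dist_real_def)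
      then have "\<bar>v x $ j / v x $ k - U0 j k / U0 k k\<bar> * \<bar>v x $ k\<bar> \<le> \<epsilon> * \<bar>v x $ k\<bar>"
        by (intro mult_right_mono) auto
      moreover have "\<bar>v x $ j / v x $ k - U0 j k / U0 k k\<bar> * \<bar>v x $ k\<bar> = \<bar>v x $ j - U0 j k / U0 k k * v x $ k\<bar>"
        using k by (simp add: abs_mult[symmetric] left_diff_distrib)
      ultimately show ?case using k by simp
    qed
  qed
qed

text \<open>Cauchy's mean value theorem for \<open>f\<close> and \<open>g\<close>; no sign of \<open>g'\<close> is needed, so that the undetermined
  sign of the limit direction is harmless.\<close>

lemma curve_stays_in_cone:
  fixes f g :: "real \<Rightarrow> real"
  assumes "0 < b" and f: "continuous_on {0..b} f" and g: "continuous_on {0..b} g"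
    and f': "\<And>t. 0 < t \<Longrightarrow> t < b \<Longrightarrow> (f has_real_derivative f' t) (at t)"
    and g': "\<And>t. 0 < t \<Longrightarrow> t < b \<Longrightarrow> (g has_real_derivative g' t) (at t)"
    and cone: "\<And>t. 0 < t \<Longrightarrow> t < b \<Longrightarrow> g' t \<noteq> 0 \<and> \<bar>f' t - r * g' t\<bar> \<le> \<epsilon> * \<bar>g' t\<bar>"
  shows "\<bar>(f b - f 0) - r * (g b - g 0)\<bar> \<le> \<epsilon> * \<bar>g b - g 0\<bar>"
proof -
  \<comment> \<open>This combination takes equal values at 0 and b, so Rolle's theorem applies to it
    without any division by the increment of g.\<close>
  let ?h = "\<lambda>t. (f b - f 0) * g t - (g b - g 0) * f t"
  have "\<exists>t. 0 < t \<and> t < b \<and> (\<lambda>x. x * ((f b - f 0) * g' t - (g b - g 0) * f' t)) = (\<lambda>v. 0)"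
  proof (rule Rolle_deriv[OF \<open>0 < b\<close>])
    show "?h 0 = ?h b" by (simp add: algebra_simps)
    show "continuous_on {0..b} ?h" by (intro continuous_intros f g)
    fix t assume t: "0 < t" "t < b"
    have "(?h has_real_derivative (f b - f 0) * g' t - (g b - g 0) * f' t) (at t)"
      by (intro DERIV_diff DERIV_cmult f'[OF t] g'[OF t])
    then show "(?h has_derivative (\<lambda>x. x * ((f b - f 0) * g' t - (g b - g 0) * f' t))) (at t)"
      unfolding has_field_derivative_def by (rule has_derivative_eq_rhs) (auto simp: mult.commute)
  qed
  then obtain t where t: "0 < t" "t < b"
    and z: "(\<lambda>x. x * ((f b - f 0) * g' t - (g b - g 0) * f' t)) = (\<lambda>v. 0)" by blast
  from fun_cong[OF z, of 1] have eq: "(f b - f 0) * g' t = (g b - g 0) * f' t" by simp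
  have "\<bar>(f b - f 0) - r * (g b - g 0)\<bar> * \<bar>g' t\<bar> = \<bar>(f b - f 0) * g' t - r * (g b - g 0) * g' t\<bar>"
    by (simp add: abs_mult[symmetric] left_diff_distrib)
  also have "\<dots> = \<bar>g b - g 0\<bar> * \<bar>f' t - r * g' t\<bar>"
    unfolding eq by (simp add: abs_mult[symmetric] algebra_simps)
  also have "\<dots> \<le> \<bar>g b - g 0\<bar> * (\<epsilon> * \<bar>g' t\<bar>)" using cone[OF t] by (intro mult_left_mono) auto
  finally have "\<bar>(f b - f 0) - r * (g b - g 0)\<bar> * \<bar>g' t\<bar> \<le> (\<epsilon> * \<bar>g b - g 0\<bar>) * \<bar>g' t\<bar>" by (simp add: mult_ac)
  then show ?thesis using cone[OF t] by (simp add: mult_le_cancel_right)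
qed

text \<open>Being future timelike is an open condition, so the orientation vector can be perturbed
  slightly along an axis j different from k. This moves component j and keeps component k, hence
  leaves the line; dimension at least 2 supplies such a j.\<close>

lemma future_timelike_off_line:
  fixes N :: "('b, 'd::finite) spacetime"
  assumes N: "continuous_spacetime N" "c \<in> st_atlas N" "q \<in> cdom c" and dim: "CARD('d) \<ge> 2"
  obtains w j where "future_timelike N c q w" "w $ j \<noteq> r j * w $ k"
proof -
  define o' where "o' = st_orient N c q"
  have oo: "ginner N c q o' o' < 0" using N unfolding continuous_spacetime_def o'_def by blast
  have "\<exists>j. j \<noteq> k"
  proof (rule ccontr)
    assume "\<not> ?thesis"
    then have "(UNIV :: 'd set) = {k}" by auto
    then have "CARD('d) = 1" by (metis card_1_singleton_iff One_nat_def)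
    then show False using dim by simp
  qed
  then obtain j where j: "j \<noteq> k" by blast
  show ?thesis
  proof (cases "o' $ j = r j * o' $ k")
    case False
    then show ?thesis using that[of o' j] oo unfolding future_timelike_def o'_def by blast
  next
    case True
    let ?w = "\<lambda>s. o' + s *\<^sub>R axis j 1"
    have "((\<lambda>s. ginner N c q (?w s) (?w s)) \<longlongrightarrow> ginner N c q (?w 0) (?w 0)) (at_right 0)"
      and "((\<lambda>s. ginner N c q o' (?w s)) \<longlongrightarrow> ginner N c q o' (?w 0)) (at_right 0)"
      unfolding ginner_def matrix_vector_mult_def by (auto intro!: tendsto_eq_intros)
    then have "\<forall>\<^sub>F s in at_right 0. ginner N c q (?w s) (?w s) < 0"
      "\<forall>\<^sub>F s in at_right 0. ginner N c q o' (?w s) < 0"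
      using oo by (auto intro: order_tendstoD)
    then have "\<forall>\<^sub>F s in at_right 0. 0 < s \<and> ginner N c q (?w s) (?w s) < 0 \<and> ginner N c q o' (?w s) < 0"
      using eventually_at_right_less[of "0::real"] by eventually_elim simp
    then obtain s :: real where "0 < s" "ginner N c q (?w s) (?w s) < 0" "ginner N c q o' (?w s) < 0"
      using eventually_happens trivial_limit_at_right_real by blast
    moreover have "?w s $ j \<noteq> r j * ?w s $ k" using True j \<open>0 < s\<close> by (simp add: axis_def)
    ultimately show ?thesis using that[of "?w s" j] unfolding future_timelike_def o'_def by blast
  qed
qed

section \<open>Behaviour at the past endpoint\<close>

text \<open>Translates continuity on a subspace of the manifold into a limit in coordinates. The
  punctured filter along \<open>B\<close> fits data of \<open>M\<close> such as \<open>u\<close>,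
  for which no value at q is given.\<close>

lemma tendsto_at_boundary_point:
  fixes f :: "'b \<Rightarrow> real"
  assumes c: "is_chart T c" and q: "q \<in> cdom c" and f: "continuous_map (subtopology T (B \<union> {q})) euclideanreal f"
  shows "((\<lambda>y. f (cinv c y)) \<longlongrightarrow> f q) (at (crd c q) within crd c ` (cdom c \<inter> B))"
proof -
  let ?S = "crd c ` (cdom c \<inter> B)"
  have "insert (crd c q) ?S \<subseteq> crd c ` cdom c" using q by auto
  then have "continuous_map (top_of_set (insert (crd c q) ?S)) T (cinv c)"
    using chart_continuous_cinv[OF c] continuous_map_from_subtopology_mono by blast
  moreover have "cinv c y \<in> B \<union> {q}" if y: "y \<in> insert (crd c q) ?S" for y
  proof -
    obtain x where "x \<in> cdom c" "x \<in> B \<union> {q}" "y = crd c x" using y q by blast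
    then show ?thesis using cinv_crd[OF c] by metis
  qed
  ultimately have "continuous_map (top_of_set (insert (crd c q) ?S)) (subtopology T (B \<union> {q})) (cinv c)"
    by (simp add: continuous_map_in_subtopology image_subset_iff)
  from continuous_map_compose[OF this f]
  have "continuous_on (insert (crd c q) ?S) (\<lambda>y. f (cinv c y))" by (simp add: comp_def)
  then have "((\<lambda>y. f (cinv c y)) \<longlongrightarrow> f (cinv c (crd c q))) (at (crd c q) within insert (crd c q) ?S)"
    unfolding continuous_on_def by blast
  then show ?thesis unfolding cinv_crd[OF c q] by (rule tendsto_within_subset) blast
qed

lemma integral_curve_translate:
  assumes "integral_curve M u \<gamma> J"
  shows "integral_curve M u (\<lambda>t. \<gamma> (t + m)) ((\<lambda>t. t - m) ` J)"
proof -
  let ?J = "(\<lambda>t. t - m) ` J"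
  have J: "is_interval J" "interior J \<noteq> {}" "continuous_map (top_of_set J) (st_top M) \<gamma>"
    and der: "\<And>t c. t \<in> J \<Longrightarrow> c \<in> st_atlas M \<Longrightarrow> \<gamma> t \<in> cdom c \<Longrightarrow>
        ((crd c \<circ> \<gamma>) has_vector_derivative u c (\<gamma> t)) (at t within J)"
    using assms unfolding integral_curve_def by auto
  have im: "(\<lambda>t. t + m) ` ?J = J" by (simp add: image_image)
  show ?thesis
    unfolding integral_curve_def
  proof (intro conjI ballI impI)
    have tr: "?J = (+) (- m) ` J" by (auto simp: image_iff)
    show "is_interval ?J" unfolding tr using J(1) by simp
    show "interior ?J \<noteq> {}" unfolding tr interior_translation using J(2) by simp
    have "continuous_map (top_of_set ?J) (top_of_set J) (\<lambda>t. t + m)"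
      unfolding continuous_map_in_subtopology using im by (auto intro!: continuous_intros)
    from continuous_map_compose[OF this J(3)]
    show "continuous_map (top_of_set ?J) (st_top M) (\<lambda>t. \<gamma> (t + m))" by (simp add: comp_def)
    fix t c assume t: "t \<in> ?J" and c: "c \<in> st_atlas M" "\<gamma> (t + m) \<in> cdom c"
    have tJ: "t + m \<in> J" using t by auto
    have "((\<lambda>t. t + m) has_vector_derivative 1) (at t within ?J)"
      by (auto intro!: derivative_eq_intros)
    moreover have "((crd c \<circ> \<gamma>) has_vector_derivative u c (\<gamma> (t + m))) (at (t + m) within (\<lambda>t. t + m) ` ?J)"
      unfolding im by (rule der[OF tJ c])
    ultimately have "((crd c \<circ> \<gamma>) \<circ> (\<lambda>t. t + m) has_vector_derivative 1 *\<^sub>R u c (\<gamma> (t + m))) (at t within ?J)"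
      by (rule vector_diff_chain_within)
    then show "((crd c \<circ> (\<lambda>t. \<gamma> (t + m))) has_vector_derivative u c (\<gamma> (t + m))) (at t within ?J)"
      by (simp add: comp_def)
  qed
qed

text \<open>A past endpoint makes \<open>J\<close> bounded below with its infimum m outside
  \<open>J\<close>, so \<open>J\<close> is \<open>{m<..0}\<close>. Shifting by b = -m gives the
  domain \<open>{0<..b}\<close> for which hypothesis (b) asserts timelikeness.\<close>

lemma past_maximal_integral_curve_from_endpoint:
  assumes \<gamma>: "integral_curve M u \<gamma> J" and J: "J \<subseteq> {..0}" "0 \<in> J"
    and e: "has_past_endpoint N \<iota> \<gamma> J q"
  obtains b where "0 < b" "integral_curve M u (\<lambda>t. \<gamma> (t - b)) {0<..b}"
    "has_past_endpoint N \<iota> (\<lambda>t. \<gamma> (t - b)) {0<..b} q"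
proof -
  define m where "m = Inf J"
  have bdd: "bdd_below J" and mJ: "m \<notin> J"
    and cont: "continuous_map (top_of_set (insert 0 ((\<lambda>t. t - m) ` J))) (st_top N)
       (with_past_endpoint \<iota> (\<lambda>t. \<gamma> (t + m)) q)"
    using e unfolding has_past_endpoint_def m_def by auto
  have m: "m \<le> t" "m \<noteq> t" if "t \<in> J" for t using cInf_lower[OF that bdd] mJ that by (auto simp: m_def)
  have m0: "m < 0" using m[OF J(2)] by simp
  have int: "is_interval J" using \<gamma> unfolding integral_curve_def by auto
  have "J = {m<..0}"
  proof (intro equalityI subsetI)
    fix t assume t: "t \<in> {m<..0}"
    then obtain s where "s \<in> J" "s < t" using cInf_less_iff[of J t] J bdd unfolding m_def by auto
    then show "t \<in> J" using int t J(2) unfolding is_interval_1 by (meson greaterThanAtMost_iff less_imp_le)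
  qed (use m J in force)
  then have "x \<in> (\<lambda>t. t - m) ` J \<longleftrightarrow> x \<in> {0<..- m}" for x
    by (auto simp: image_iff intro: bexI[of _ "x + m"])
  then have im: "(\<lambda>t. t - m) ` J = {0<..- m}" by blast
  have inf: "Inf {0<..- m} = 0" using m0 by simp
  show ?thesis
  proof (rule that[of "- m"])
    show "0 < - m" using m0 by simp
    show "integral_curve M u (\<lambda>t. \<gamma> (t - - m)) {0<..- m}"
      using integral_curve_translate[OF \<gamma>, of m] unfolding im by simp
    show "has_past_endpoint N \<iota> (\<lambda>t. \<gamma> (t - - m)) {0<..- m} q"
      using cont unfolding has_past_endpoint_def im inf by simp
  qed
qed

text \<open>Strong causality is formulated for causal curves. A global Lipschitz constant serves
  locally with any radius, and a timelike vector is nonzero because g(0,0) = 0.\<close>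

lemma timelike_imp_causal_curve:
  assumes "timelike_curve N \<gamma> a b"
  shows "causal_curve N \<gamma> a b"
proof -
  obtain h L where L: "\<gamma> ` {a..b} \<subseteq> pts N" "complete_riemannian_metric (st_top N) (st_atlas N) h"
    "\<forall>s\<in>{a..b}. \<forall>t\<in>{a..b}. riem_dist (st_top N) (st_atlas N) h (\<gamma> s) (\<gamma> t) \<le> L * \<bar>s - t\<bar>"
    using assms unfolding timelike_curve_def lipschitz_curve_def by blast
  have "\<exists>e>0. \<exists>L. \<forall>s \<in> {a..b} \<inter> ball r e. \<forall>t \<in> {a..b} \<inter> ball r e.
          riem_dist (st_top N) (st_atlas N) h (\<gamma> s) (\<gamma> t) \<le> L * \<bar>s - t\<bar>" for r
    by (intro exI[of _ 1] exI[of _ L] conjI) (use L(3) in auto)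
  then have lip: "locally_lipschitz_curve N \<gamma> a b"
    unfolding locally_lipschitz_curve_def using L(1,2) by blast
  obtain \<epsilon> where ae: "AE t in lebesgue_on {a..b}. \<forall>c \<in> st_atlas N. \<gamma> t \<in> cdom c \<longrightarrow>
        (\<exists>v. ((crd c \<circ> \<gamma>) has_vector_derivative v) (at t) \<and>
             future_timelike N c (\<gamma> t) v \<and> ginner N c (\<gamma> t) v v < - \<epsilon>)"
    using assms unfolding timelike_curve_def by blast
  have causal: "future_causal N c x v" if "future_timelike N c x v" for c x v
    using that unfolding future_timelike_def future_causal_def ginner_def by auto
  have "AE t in lebesgue_on {a..b}. \<forall>c \<in> st_atlas N. \<gamma> t \<in> cdom c \<longrightarrow>
        (\<exists>v. ((crd c \<circ> \<gamma>) has_vector_derivative v) (at t) \<and> future_causal N c (\<gamma> t) v)"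
    using ae by (rule AE_mp) (intro AE_I2 impI, use causal in blast)
  then show ?thesis using assms lip unfolding causal_curve_def timelike_curve_def by blast
qed

lemma symmetric_matrix_inner_axis:
  fixes G :: "real ^ 'd::finite ^ 'd"
  assumes "transpose G = G"
  shows "v \<bullet> (G *v axis i 1) = (G *v v) $ i"
proof -
  have "v \<bullet> (G *v axis i 1) = (v v* G) \<bullet> axis i 1" by (simp add: dot_lmul_matrix)
  also have "\<dots> = (transpose G *v v) $ i" by (simp add: inner_axis)
  finally show ?thesis unfolding assms .
qed

text \<open>In the pulled-back chart the metric components of \<open>M\<close> are those of
  \<open>N\<close>, so they converge at q, as do the Ricci components, \<rho> and p by their
  extensions. This is the situation of \<open>direction_converges\<close>, for the filter of
  coordinates of points of \<open>M\<close> near q.\<close>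

lemma fluid_direction_converges:
  fixes M :: "('a, 'd::finite) spacetime" and N :: "('b, 'd) spacetime"
  assumes ext: "continuous_extension M N \<iota>" and c: "c \<in> st_atlas N" "q \<in> cdom c"
    and fluid: "perfect_fluid M u \<rho> p" and einstein: "einstein_perfect_fluid M u \<rho> p"
    and ric: "\<And>i j. continuous_map (subtopology (st_top N) ((cdom c \<inter> \<iota> ` pts M) \<union> {q})) euclideanreal (R i j)"
      "\<And>i j x. x \<in> pts M \<Longrightarrow> \<iota> x \<in> cdom c \<Longrightarrow> R i j (\<iota> x) = ricci M (pull_chart M \<iota> c) x $ i $ j"
    and \<rho>: "is_continuous_extension_of M N \<iota> q \<rho> \<rho>'" and p: "is_continuous_extension_of M N \<iota> q p p'"
    and ne: "\<rho>' q + p' q \<noteq> 0"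
  obtains r k where "\<And>j \<epsilon>. 0 < \<epsilon> \<Longrightarrow>
    \<forall>\<^sub>F y in at (crd c q) within crd c ` (cdom c \<inter> \<iota> ` pts M).
      u (pull_chart M \<iota> c) (cinv (pull_chart M \<iota> c) y) $ k \<noteq> 0 \<and>
      \<bar>u (pull_chart M \<iota> c) (cinv (pull_chart M \<iota> c) y) $ j - r j * u (pull_chart M \<iota> c) (cinv (pull_chart M \<iota> c) y) $ k\<bar>
        \<le> \<epsilon> * \<bar>u (pull_chart M \<iota> c) (cinv (pull_chart M \<iota> c) y) $ k\<bar>"
proof -
  let ?P = "pull_chart M \<iota> c"
  let ?S = "crd c ` (cdom c \<inter> \<iota> ` pts M)"
  let ?F = "at (crd c q) within ?S"
  let ?G = "\<lambda>y. st_metric N c (cinv c y)" and ?X = "cinv ?P"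
  have M: "smooth_manifold (st_top M) (st_atlas M)" and N: "smooth_manifold (st_top N) (st_atlas N)"
    and iso: "isometric_embedding M N \<iota>" and emb: "smooth_embedding M N \<iota>" and Nc: "continuous_spacetime N"
    using ext unfolding continuous_extension_def smooth_spacetime_def continuous_spacetime_def
      isometric_embedding_def by auto
  have ch: "is_chart (st_top N) c" using manifold_chart[OF N c(1)] .
  have PA: "?P \<in> st_atlas M" using pull_chart_in_atlas[OF M N emb c(1)] .
  have P: "is_chart (st_top M) ?P" using manifold_chart[OF M PA] .
  have inj: "inj_on \<iota> (pts M)"
    using emb unfolding smooth_embedding_def embedding_map_def
    using homeomorphic_imp_injective_map by blast
  have X: "\<exists>x. ?X y = x \<and> cinv c y = \<iota> x \<and> x \<in> pts M \<and> \<iota> x \<in> cdom c \<and> y = crd c (\<iota> x)"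
    if y: "y \<in> ?S" for y
  proof -
    obtain x where x: "x \<in> pts M" "\<iota> x \<in> cdom c" "y = crd c (\<iota> x)" using y by blast
    then show ?thesis using cinv_pull_chart(1)[OF P ch inj x(1,2)] cinv_crd[OF ch x(2)] by auto
  qed
  have inF: "\<forall>\<^sub>F y in ?F. y \<in> ?S" by (simp add: eventually_at_filter)
  have metric: "st_metric M ?P x = st_metric N c (\<iota> x)" if "x \<in> pts M" "\<iota> x \<in> cdom c" for x
    using pull_chart_metric[OF M N iso c(1) that] .
  have lor: "lorentzian_matrix (st_metric N c x)" if "x \<in> cdom c" for x
    using Nc c(1) that unfolding continuous_spacetime_def by blast
  have sym: "transpose (st_metric N c x) = st_metric N c x" if "x \<in> cdom c" for x
    using lor[OF that] unfolding lorentzian_matrix_def by blast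
  have lim: "((\<lambda>y. f (cinv c y)) \<longlongrightarrow> f q) ?F"
    if "continuous_map (subtopology (st_top N) (\<iota> ` pts M \<union> {q})) euclideanreal f" for f
    using tendsto_at_boundary_point[OF ch c(2) that] .
  have lim': "((\<lambda>y. g (?X y)) \<longlongrightarrow> f q) ?F" if f: "((\<lambda>y. f (cinv c y)) \<longlongrightarrow> f q) ?F"
    and eq: "\<And>x. x \<in> pts M \<Longrightarrow> \<iota> x \<in> cdom c \<Longrightarrow> f (\<iota> x) = g x" for f :: "'b \<Rightarrow> real" and g
  proof -
    have "\<forall>\<^sub>F y in ?F. f (cinv c y) = g (?X y)"
      using inF by eventually_elim (use X eq in metis)
    then show ?thesis using f tendsto_cong by fast
  qed
  show ?thesis
  proof (rule direction_converges[where F = ?F and G = ?G and R = "\<lambda>y. ricci M ?P (?X y)" and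
        v = "\<lambda>y. u ?P (?X y)" and \<rho> = "\<lambda>y. \<rho> (?X y)" and p = "\<lambda>y. p (?X y)" and
        ?G0.0 = "st_metric N c q" and ?R0.0 = "\<lambda>i j. R i j q" and a = "\<rho>' q" and b = "p' q"])
    show "\<forall>\<^sub>F y in ?F. \<forall>i j. ricci M ?P (?X y) $ i $ j
        - 1/2 * (\<Sum>k\<in>UNIV. \<Sum>l\<in>UNIV. matrix_inv (?G y) $ k $ l * ricci M ?P (?X y) $ k $ l) * ?G y $ i $ j =
      8 * pi * ((\<rho> (?X y) + p (?X y)) * ((?G y *v u ?P (?X y)) $ i * (?G y *v u ?P (?X y)) $ j)
        + p (?X y) * ?G y $ i $ j)"
      using inF
    proof eventually_elim
      case (elim y)
      obtain x where x: "?X y = x" "cinv c y = \<iota> x" "x \<in> pts M" "\<iota> x \<in> cdom c" using X[OF elim] by blast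
      have lo: "lower M u ?P x $ i = (st_metric N c (\<iota> x) *v u ?P x) $ i" for i
        unfolding lower_def ginner_def metric[OF x(3,4)]
        using symmetric_matrix_inner_axis[OF sym[OF x(4)]] by simp
      have "x \<in> cdom ?P" using x by simp
      then have "\<forall>i j. ricci M ?P x $ i $ j - 1/2 * scalar_curv M ?P x * st_metric M ?P x $ i $ j =
          8 * pi * ((\<rho> x + p x) * (lower M u ?P x $ i * lower M u ?P x $ j) + p x * st_metric M ?P x $ i $ j)"
        using einstein PA unfolding einstein_perfect_fluid_def by blast
      then show ?case unfolding scalar_curv_def lo metric[OF x(3,4)] x(1,2) .
    qed
    show "\<forall>\<^sub>F y in ?F. u ?P (?X y) \<bullet> (?G y *v u ?P (?X y)) = - 1"
      using inF
    proof eventually_elim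
      case (elim y)
      obtain x where x: "?X y = x" "cinv c y = \<iota> x" "x \<in> pts M" "\<iota> x \<in> cdom c" using X[OF elim] by blast
      have "x \<in> cdom ?P" using x by simp
      then have "ginner M ?P x (u ?P x) (u ?P x) = - 1" using fluid PA unfolding perfect_fluid_def by blast
      then show ?case unfolding x ginner_def metric[OF x(3,4)] .
    qed
    have "continuous_on (crd c ` cdom c) (st_metric N c \<circ> cinv c)"
      using Nc c(1) unfolding continuous_spacetime_def continuous_comps_def by blast
    then have "(?G \<longlongrightarrow> ?G (crd c q)) (at (crd c q) within crd c ` cdom c)"
      using c(2) unfolding continuous_on_def comp_def by blast
    then have "(?G \<longlongrightarrow> st_metric N c q) ?F"
      unfolding cinv_crd[OF ch c(2)] by (rule tendsto_within_subset) blast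
    then show "((\<lambda>y. ?G y $ i $ j) \<longlongrightarrow> st_metric N c q $ i $ j) ?F" for i j
      by (intro tendsto_vec_nth)
    show "invertible (st_metric N c q)" using lorentzian_invertible[OF lor[OF c(2)]] .
    show "\<forall>\<^sub>F y in ?F. invertible (?G y)"
      using inF by eventually_elim (use X lorentzian_invertible lor in metis)
    show "((\<lambda>y. ricci M ?P (?X y) $ i $ j) \<longlongrightarrow> R i j q) ?F" for i j
    proof (rule lim')
      have "cdom c \<inter> (cdom c \<inter> \<iota> ` pts M) = cdom c \<inter> \<iota> ` pts M" by blast
      then show "((\<lambda>y. R i j (cinv c y)) \<longlongrightarrow> R i j q) ?F"
        using tendsto_at_boundary_point[OF ch c(2) ric(1)] by metis
    qed (rule ric(2))
    show "((\<lambda>y. \<rho> (?X y)) \<longlongrightarrow> \<rho>' q) ?F" "((\<lambda>y. p (?X y)) \<longlongrightarrow> p' q) ?F"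
      using \<rho> p unfolding is_continuous_extension_of_def by (auto intro!: lim' lim)
    show "\<rho>' q + p' q \<noteq> 0" by (rule ne)
  qed (rule that)
qed

theorem theorem2p2:
  fixes M :: "('a, 'd::finite) spacetime" and Mext :: "('b, 'd) spacetime"
    and \<iota> :: "'a \<Rightarrow> 'b" and \<O> :: 'b
    and u :: "('a, 'd) vfield" and \<rho> p :: "'a \<Rightarrow> real" and \<rho>' p' :: "'b \<Rightarrow> real"
  assumes dim: "CARD('d) \<ge> 2"
    and ext: "continuous_extension M Mext \<iota>"
    and past: "\<O> \<in> past_boundary M Mext \<iota>"
    and future: "\<iota> ` pts M = timelike_future \<O> Mext"
    and fluid: "perfect_fluid M u \<rho> p"
    and einstein: "einstein_perfect_fluid M u \<rho> p"
    and endpoint: "\<And>\<gamma> J. past_maximal_integral_curve M u \<gamma> J \<Longrightarrow> has_past_endpoint Mext \<iota> \<gamma> J \<O>"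
    and timelike: "\<And>\<gamma> b. 0 < b \<Longrightarrow> integral_curve M u \<gamma> {0<..b} \<Longrightarrow>
           has_past_endpoint Mext \<iota> \<gamma> {0<..b} \<O> \<Longrightarrow>
           timelike_curve Mext (with_past_endpoint \<iota> \<gamma> \<O>) 0 b"
    and ric_ext: "tensor2_extends_continuously M Mext \<iota> \<O> (ricci M)"
    and rho_ext: "is_continuous_extension_of M Mext \<iota> \<O> \<rho> \<rho>'"
    and p_ext: "is_continuous_extension_of M Mext \<iota> \<O> p p'"
    and causal: "strongly_causal_at Mext \<O>"
  shows "\<rho>' \<O> = - p' \<O>"
proof (rule ccontr)
  assume "\<rho>' \<O> \<noteq> - p' \<O>"
  then have ne: "\<rho>' \<O> + p' \<O> \<noteq> 0" by simp
  have M: "smooth_manifold (st_top M) (st_atlas M)" and N: "smooth_manifold (st_top Mext) (st_atlas Mext)"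
    and emb: "smooth_embedding M Mext \<iota>" and Nc: "continuous_spacetime Mext"
    using ext unfolding continuous_extension_def smooth_spacetime_def continuous_spacetime_def
      isometric_embedding_def by auto
  have inj: "inj_on \<iota> (pts M)"
    using emb unfolding smooth_embedding_def embedding_map_def
    using homeomorphic_imp_injective_map by blast
  obtain c where c: "c \<in> st_atlas Mext" "\<O> \<in> cdom c" and "\<forall>i j. \<exists>F.
        continuous_map (subtopology (st_top Mext) ((cdom c \<inter> \<iota> ` pts M) \<union> {\<O>})) euclideanreal F \<and>
        (\<forall>x \<in> pts M. \<iota> x \<in> cdom c \<longrightarrow> F (\<iota> x) = ricci M (pull_chart M \<iota> c) x $ i $ j)"
    (is "\<forall>i j. \<exists>F. ?Q i j F")
    using ric_ext unfolding tensor2_extends_continuously_def by blast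
  then obtain R where "\<forall>i j. ?Q i j (R i j)" unfolding choice_iff by blast
  then have R:
    "\<And>i j. continuous_map (subtopology (st_top Mext) ((cdom c \<inter> \<iota> ` pts M) \<union> {\<O>})) euclideanreal (R i j)"
    "\<And>i j x. x \<in> pts M \<Longrightarrow> \<iota> x \<in> cdom c \<Longrightarrow> R i j (\<iota> x) = ricci M (pull_chart M \<iota> c) x $ i $ j"
    by blast+
  let ?P = "pull_chart M \<iota> c" and ?S = "crd c ` (cdom c \<inter> \<iota> ` pts M)" and ?y = "crd c \<O>"
  have ch: "is_chart (st_top Mext) c" using manifold_chart[OF N c(1)] .
  have PA: "?P \<in> st_atlas M" using pull_chart_in_atlas[OF M N emb c(1)] .
  have P: "is_chart (st_top M) ?P" using manifold_chart[OF M PA] .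
  let ?v = "\<lambda>y. u ?P (cinv ?P y)"
  obtain r k where rk: "\<And>j \<epsilon>. 0 < \<epsilon> \<Longrightarrow> \<forall>\<^sub>F y in at ?y within ?S.
      ?v y $ k \<noteq> 0 \<and> \<bar>?v y $ j - r j * ?v y $ k\<bar> \<le> \<epsilon> * \<bar>?v y $ k\<bar>"
    by (rule fluid_direction_converges[OF ext c fluid einstein _ _ rho_ext p_ext ne, where R = R])
      (rule R(1), erule (1) R(2), rule that)
  obtain w j where w: "future_timelike Mext c \<O> w" "w $ j \<noteq> r j * w $ k"
    using future_timelike_off_line[OF Nc c dim] .
  \<comment> \<open>The cone of this width around the limit line excludes w; the summand 1 covers
    the case that component k of w is zero.\<close>
  define \<epsilon> where "\<epsilon> = \<bar>w $ j - r j * w $ k\<bar> / (\<bar>w $ k\<bar> + 1)"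
  have eps: "0 < \<epsilon>" "\<epsilon> * \<bar>w $ k\<bar> < \<bar>w $ j - r j * w $ k\<bar>"
    using w(2) unfolding \<epsilon>_def by (simp_all add: field_simps add_pos_nonneg)
  obtain Y where Y: "open Y" "?y \<in> Y" "\<And>y. y \<in> Y \<Longrightarrow> y \<noteq> ?y \<Longrightarrow> y \<in> ?S \<Longrightarrow>
      ?v y $ k \<noteq> 0 \<and> \<bar>?v y $ j - r j * ?v y $ k\<bar> \<le> \<epsilon> * \<bar>?v y $ k\<bar>"
    using rk[OF eps(1), of j] unfolding eventually_at_topological by blast
  \<comment> \<open>The part of the chart where the cone estimate is available, and hence where the
    flow line must be confined.\<close>
  define U where "U = {x \<in> cdom c. crd c x \<in> Y}"
  have "openin (st_top Mext) U" "\<O> \<in> U"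
    using chart_open_preimage[OF ch Y(1)] c(2) Y(2) by (auto simp: U_def)
  then have "\<exists>V. openin (st_top Mext) V \<and> \<O> \<in> V \<and> V \<subseteq> U \<and>
      (\<forall>\<gamma> a b. causal_curve Mext \<gamma> a b \<and> \<gamma> a \<in> V \<and> \<gamma> b \<in> V \<longrightarrow> \<gamma> ` {a..b} \<subseteq> U)"
    using causal unfolding strongly_causal_at_def by simp
  then obtain V where V: "openin (st_top Mext) V" "\<O> \<in> V" "V \<subseteq> U"
    and confined: "\<forall>\<gamma> a b. causal_curve Mext \<gamma> a b \<and> \<gamma> a \<in> V \<and> \<gamma> b \<in> V \<longrightarrow> \<gamma> ` {a..b} \<subseteq> U"
    by (elim exE conjE) (rule that)
  have Vc: "V \<subseteq> cdom c" using V(3) unfolding U_def by blast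
  \<comment> \<open>The complete Riemannian metric is taken from the timelike curve that witnesses
    \<O> as a point of the past boundary.\<close>
  obtain h where h: "complete_riemannian_metric (st_top Mext) (st_atlas Mext) h"
    using past unfolding past_boundary_def timelike_curve_def lipschitz_curve_def by blast
  obtain b0 where b0: "0 < b0" "\<And>b. 0 < b \<Longrightarrow> b \<le> b0 \<Longrightarrow> ?y + b *\<^sub>R w \<in> crd c ` cdom c \<and>
      cinv c (?y + b *\<^sub>R w) \<in> timelike_future \<O> Mext"
    by (rule timelike_chart_line[OF Nc c h w(1)]) (rule that)
  have "?y + 0 *\<^sub>R w \<in> crd c ` V" using V(2) by simp
  then obtain e where e: "e > 0" "\<And>s. \<bar>s - 0\<bar> < e \<Longrightarrow> ?y + s *\<^sub>R w \<in> crd c ` V"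
    by (rule eventually_segment_in_open[OF chart_open_image[OF ch V(1) Vc]]) (rule that)
  \<comment> \<open>Short enough for two purposes: the end of the segment lies in the timelike
    future of \<O>, which is \<open>M\<close>, and also in \<open>V\<close>.\<close>
  define s where "s = min b0 (e / 2)"
  have s: "0 < s" "s \<le> b0" "\<bar>s - 0\<bar> < e" using b0(1) e(1) by (auto simp: s_def)
  obtain z where z: "z \<in> V" "?y + s *\<^sub>R w = crd c z" using e(2)[OF s(3)] by blast
  have "z \<in> timelike_future \<O> Mext"
    using b0(2)[OF s(1,2)] z cinv_crd[OF ch, of z] Vc by auto
  then obtain x where x: "x \<in> pts M" "z = \<iota> x" using future by blast
  have uv: "vector_field (st_atlas M) u" "smooth_comps (st_atlas M) u"
    using fluid unfolding perfect_fluid_def by auto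
  obtain \<gamma> J where \<gamma>: "past_maximal_integral_curve M u \<gamma> J" "J \<subseteq> {..0}" "0 \<in> J" "\<gamma> 0 = x"
    using past_maximal_integral_curve_exists[OF M uv x(1)] .
  have "integral_curve M u \<gamma> J" using \<gamma>(1) unfolding past_maximal_integral_curve_def by blast
  then obtain b where b: "0 < b" "integral_curve M u (\<lambda>t. \<gamma> (t - b)) {0<..b}"
    "has_past_endpoint Mext \<iota> (\<lambda>t. \<gamma> (t - b)) {0<..b} \<O>"
    by (rule past_maximal_integral_curve_from_endpoint[OF _ \<gamma>(2,3) endpoint[OF \<gamma>(1)]]) (rule that)
  define \<sigma> where "\<sigma> = (\<lambda>t. \<gamma> (t - b))"
  define \<tau> where "\<tau> = with_past_endpoint \<iota> \<sigma> \<O>"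
  have \<tau>: "\<tau> 0 = \<O>" "\<tau> b = z" "\<And>t. 0 < t \<Longrightarrow> \<tau> t = \<iota> (\<sigma> t)"
    using b(1) \<gamma>(4) x(2) by (auto simp: \<tau>_def \<sigma>_def with_past_endpoint_def)
  \<comment> \<open>The extended flow line joins \<O> to z, both in \<open>V\<close>, so strong
    causality keeps it in \<open>U\<close> throughout, whatever its parameter length b.\<close>
  have "causal_curve Mext \<tau> 0 b"
    using timelike_imp_causal_curve[OF timelike[OF b]] unfolding \<tau>_def \<sigma>_def .
  then have "\<tau> ` {0..b} \<subseteq> U"
    using confined[rule_format, of \<tau> 0 b] V(2) z(1) \<tau>(1,2) by simp
  then have \<tau>U: "\<tau> t \<in> U" if "t \<in> {0..b}" for t using that by blast
  define f where "f t = crd c (\<tau> t)" for t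
  have f_cont: "continuous_on {0..b} f"
  proof -
    have "insert 0 ((\<lambda>t. t - Inf {0<..b}) ` {0<..b}) = {0..b}" using b(1) by auto
    then have "continuous_map (top_of_set {0..b}) (st_top Mext) \<tau>"
      using b(1,3) unfolding has_past_endpoint_def \<tau>_def \<sigma>_def by simp
    then have "continuous_map (top_of_set {0..b}) (subtopology (st_top Mext) (cdom c)) \<tau>"
      using \<tau>U by (auto simp: continuous_map_in_subtopology U_def)
    from continuous_map_compose[OF this chart_continuous_crd[OF ch]]
    show ?thesis by (simp add: f_def[abs_def] comp_def)
  qed
  have der: "((\<lambda>t. f t $ i) has_real_derivative ?v (f t) $ i) (at t)" if t: "0 < t" "t < b" for t i
  proof -
    have pt: "\<sigma> t \<in> pts M" "\<iota> (\<sigma> t) \<in> cdom c"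
      using b(2) t \<tau>U[of t] \<tau>(3)[OF t(1)] continuous_map_image_subset_topspace
      unfolding integral_curve_def \<sigma>_def U_def by (fastforce, simp)
    have ft: "f t = crd c (\<iota> (\<sigma> t))" using \<tau>(3)[OF t(1)] by (simp add: f_def)
    have "cinv ?P (f t) = \<sigma> t" using cinv_pull_chart(1)[OF P ch inj pt] ft by simp
    moreover have "((crd ?P \<circ> \<sigma>) has_vector_derivative u ?P (\<sigma> t)) (at t within {0<..b})"
    proof -
      have "\<forall>t\<in>{0<..b}. \<forall>c \<in> st_atlas M. \<sigma> t \<in> cdom c \<longrightarrow>
          ((crd c \<circ> \<sigma>) has_vector_derivative u c (\<sigma> t)) (at t within {0<..b})"
        using b(2) unfolding integral_curve_def \<sigma>_def by blast
      moreover have "t \<in> {0<..b}" "\<sigma> t \<in> cdom ?P" using t pt by auto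
      ultimately show ?thesis using PA by blast
    qed
    ultimately have "((crd ?P \<circ> \<sigma>) has_vector_derivative ?v (f t)) (at t)"
      using t at_within_interior[of t "{0<..b}"] by simp
    then have "(f has_vector_derivative ?v (f t)) (at t)"
      by (rule has_vector_derivative_transform_within_open[where S = "{0<..}"])
        (use t \<tau>(3) in \<open>auto simp: f_def\<close>)
    then show ?thesis
      using bounded_linear.has_vector_derivative[OF bounded_linear_vec_nth]
      unfolding has_real_derivative_iff_has_vector_derivative by blast
  qed
  have "\<bar>(f b $ j - f 0 $ j) - r j * (f b $ k - f 0 $ k)\<bar> \<le> \<epsilon> * \<bar>f b $ k - f 0 $ k\<bar>"
  proof (rule curve_stays_in_cone[OF b(1)])
    show "?v (f t) $ k \<noteq> 0 \<and> \<bar>?v (f t) $ j - r j * ?v (f t) $ k\<bar> \<le> \<epsilon> * \<bar>?v (f t) $ k\<bar>"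
      if t: "0 < t" "t < b" for t
    proof (rule Y(3))
      show "f t \<in> Y" using \<tau>U[of t] t unfolding U_def f_def by auto
      have mem: "\<tau> t \<in> cdom c" using \<tau>U[of t] t unfolding U_def by auto
      have im: "\<tau> t \<in> \<iota> ` pts M"
        using b(2) t \<tau>(3)[OF t(1)] continuous_map_image_subset_topspace
        unfolding integral_curve_def \<sigma>_def by fastforce
      show "f t \<in> ?S" using mem im unfolding f_def by blast
      \<comment> \<open>The cone estimate holds only away from the coordinates of \<O>. Interior
        points of the flow line lie in \<open>M\<close>, whereas \<O> is a boundary point, so they
        differ from it.\<close>
      have "\<O> \<notin> \<iota> ` pts M" using past unfolding past_boundary_def boundary_of_image_def by blast
      then show "f t \<noteq> ?y" using im mem c(2) chart_inj_on[OF ch] unfolding f_def inj_on_def by metis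
    qed
  qed (use f_cont der in \<open>auto intro!: continuous_intros\<close>)
  \<comment> \<open>The chord of the flow line is exactly s w, so the cone estimate, divided by the
    positive s, contradicts the choice of \<open>\<epsilon>\<close>.\<close>
  moreover have "f b = f 0 + s *\<^sub>R w" using \<tau>(1,2) z(2) by (simp add: f_def)
  ultimately have "\<bar>s * (w $ j - r j * w $ k)\<bar> \<le> \<epsilon> * \<bar>s * w $ k\<bar>" by (simp add: algebra_simps)
  then have "s * \<bar>w $ j - r j * w $ k\<bar> \<le> s * (\<epsilon> * \<bar>w $ k\<bar>)"
    using s(1) by (simp add: abs_mult mult_ac)
  then show False using eps(2) s(1) by simp
qed

end
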